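(* Let $k$ be a field and let $A$ be a finite dimensional DGA over $k$ such that $A/J$ is $k$-separable, where $J$ is the Jacobson radical of the underlying ungraded algebra of $A$. If $M \in \mathcal{D}(A)$ is such that $M \otimes_A^{\mathbb{L}} A/J_- \simeq 0$, then $M \simeq 0$.
   Context: $k$ is a field. DGAs are (cohomologically $\mathbb{Z}$-graded) differential graded $k$-algebras, modules are right DG modules unless stated otherwise, and $\mathcal{D}(A)$ is the derived category of right DG $A$-modules. A DGA $A$ is finite dimensional (a fd DGA) if each $A^i$ is finite dimensional over $k$ and $A^i=0$ for $|i|\gg 0$. For a fd DGA $A$, $J=J(A)$ denotes the Jacobson radical of the underlying algebra of $A$ (forgetting grading and differential), and $J_- := \{ r \in J \mid d(r) \in J\}$, which is a nilpotent two-sided DG ideal of $A$; $A/J_-$ is the quotient DGA, viewed as a DG $A$-bimodule. A finite dimensional $k$-algebra is $k$-separable if it is separable over $k$ in the usual sense. *)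

theory Defs
  imports "HOL-Algebra.Module" "HOL-Algebra.QuotRing" "HOL-Algebra.Free_Abelian_Groups"
begin

section \<open>Algebras over a field\<close>

text \<open>
  The library locale \<^locale>\<open>algebra\<close> asks the algebra to be commutative, hence a separate
  locale for associative unital algebras.
\<close>

locale assoc_algebra = module k A + ring A for k (structure) and A (structure) +
  assumes smult_mult_left:
      "\<lbrakk>c \<in> carrier k; x \<in> carrier A; y \<in> carrier A\<rbrakk> \<Longrightarrow> (c \<odot>\<^bsub>A\<^esub> x) \<otimes>\<^bsub>A\<^esub> y = c \<odot>\<^bsub>A\<^esub> (x \<otimes>\<^bsub>A\<^esub> y)"
    and smult_mult_right:
      "\<lbrakk>c \<in> carrier k; x \<in> carrier A; y \<in> carrier A\<rbrakk> \<Longrightarrow> x \<otimes>\<^bsub>A\<^esub> (c \<odot>\<^bsub>A\<^esub> y) = c \<odot>\<^bsub>A\<^esub> (x \<otimes>\<^bsub>A\<^esub> y)"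

definition finite_dim_subspace ::
    "('k, 'z) ring_scheme \<Rightarrow> ('k, 'v, 'y) module_scheme \<Rightarrow> 'v set \<Rightarrow> bool" where
  "finite_dim_subspace k V W \<longleftrightarrow> submodule W k V \<and>
     (\<exists>B. finite B \<and> B \<subseteq> W \<and>
        (\<forall>x\<in>W. \<exists>c\<in>B \<rightarrow> carrier k. x = (\<Oplus>\<^bsub>V\<^esub>b\<in>B. c b \<odot>\<^bsub>V\<^esub> b)))"

definition right_ideal :: "('a, 'z) ring_scheme \<Rightarrow> 'a set \<Rightarrow> bool" where
  "right_ideal A I \<longleftrightarrow> additive_subgroup I A \<and> (\<forall>x\<in>I. \<forall>a\<in>carrier A. x \<otimes>\<^bsub>A\<^esub> a \<in> I)"

definition maximal_right_ideal :: "('a, 'z) ring_scheme \<Rightarrow> 'a set \<Rightarrow> bool" where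
  "maximal_right_ideal A I \<longleftrightarrow> right_ideal A I \<and> I \<noteq> carrier A \<and>
     (\<forall>K. right_ideal A K \<and> I \<subseteq> K \<longrightarrow> K = I \<or> K = carrier A)"

definition jacobson_radical :: "('a, 'z) ring_scheme \<Rightarrow> 'a set" where
  "jacobson_radical A = {x \<in> carrier A. \<forall>I. maximal_right_ideal A I \<longrightarrow> x \<in> I}"

definition quotient_algebra :: "('k, 'a, 'z) module_scheme \<Rightarrow> 'a set \<Rightarrow> ('k, 'a set) module" where
  "quotient_algebra A I =
     \<lparr>carrier = carrier (A Quot I), monoid.mult = monoid.mult (A Quot I), one = one (A Quot I),
      ring.zero = ring.zero (A Quot I), ring.add = ring.add (A Quot I),
      smult = (\<lambda>c C. \<Union>x\<in>C. I +>\<^bsub>A\<^esub> (c \<odot>\<^bsub>A\<^esub> x))\<rparr>"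


section \<open>Tensor products of modules\<close>

text \<open>
  The tensor product of a right module \<open>P\<close> and a left module \<open>Q\<close> over a ring with carrier \<open>S\<close>:
  the free abelian group on pairs modulo biadditivity and \<open>(x r, y) = (x, r y)\<close>. The two
  actions are passed as functions because the same construction is used over \<open>k\<close> and over \<open>A\<close>.
\<close>

definition tensor_relators ::
    "'r set \<Rightarrow> ('p, 'y) ring_scheme \<Rightarrow> ('p \<Rightarrow> 'r \<Rightarrow> 'p) \<Rightarrow> ('q, 'z) ring_scheme \<Rightarrow> ('r \<Rightarrow> 'q \<Rightarrow> 'q)
      \<Rightarrow> ('p \<times> 'q \<Rightarrow>\<^sub>0 int) set" where
  "tensor_relators S P rp Q lq =
     {frag_of (x \<oplus>\<^bsub>P\<^esub> x', y) - frag_of (x, y) - frag_of (x', y) | x x' y.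
        x \<in> carrier P \<and> x' \<in> carrier P \<and> y \<in> carrier Q} \<union>
     {frag_of (x, y \<oplus>\<^bsub>Q\<^esub> y') - frag_of (x, y) - frag_of (x, y') | x y y'.
        x \<in> carrier P \<and> y \<in> carrier Q \<and> y' \<in> carrier Q} \<union>
     {frag_of (rp x r, y) - frag_of (x, lq r y) | x r y.
        x \<in> carrier P \<and> r \<in> S \<and> y \<in> carrier Q}"

definition tensor_free ::
    "('p, 'y) ring_scheme \<Rightarrow> ('q, 'z) ring_scheme \<Rightarrow> ('p \<times> 'q \<Rightarrow>\<^sub>0 int) monoid" where
  "tensor_free P Q = free_Abelian_group (carrier P \<times> carrier Q)"

definition tensor_null ::
    "'r set \<Rightarrow> ('p, 'y) ring_scheme \<Rightarrow> ('p \<Rightarrow> 'r \<Rightarrow> 'p) \<Rightarrow> ('q, 'z) ring_scheme \<Rightarrow> ('r \<Rightarrow> 'q \<Rightarrow> 'q)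
      \<Rightarrow> ('p \<times> 'q \<Rightarrow>\<^sub>0 int) set" where
  "tensor_null S P rp Q lq = generate (tensor_free P Q) (tensor_relators S P rp Q lq)"

definition tensor_class ::
    "'r set \<Rightarrow> ('p, 'y) ring_scheme \<Rightarrow> ('p \<Rightarrow> 'r \<Rightarrow> 'p) \<Rightarrow> ('q, 'z) ring_scheme \<Rightarrow> ('r \<Rightarrow> 'q \<Rightarrow> 'q)
      \<Rightarrow> ('p \<times> 'q \<Rightarrow>\<^sub>0 int) \<Rightarrow> ('p \<times> 'q \<Rightarrow>\<^sub>0 int) set" where
  "tensor_class S P rp Q lq u = tensor_null S P rp Q lq #>\<^bsub>tensor_free P Q\<^esub> u"

definition tensor_group ::
    "'r set \<Rightarrow> ('p, 'y) ring_scheme \<Rightarrow> ('p \<Rightarrow> 'r \<Rightarrow> 'p) \<Rightarrow> ('q, 'z) ring_scheme \<Rightarrow> ('r \<Rightarrow> 'q \<Rightarrow> 'q)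
      \<Rightarrow> ('p \<times> 'q \<Rightarrow>\<^sub>0 int) set monoid" where
  "tensor_group S P rp Q lq = tensor_free P Q Mod tensor_null S P rp Q lq"

text \<open>
  \<open>B\<close> is separable over \<open>k\<close> if \<open>B \<otimes>\<^sub>k B\<close> contains a separability idempotent
  \<open>\<Sum> x\<^sub>i \<otimes> y\<^sub>i\<close>, i.e. the multiplication \<open>B \<otimes>\<^sub>k B \<rightarrow> B\<close> splits as a map of bimodules.
\<close>

definition separable_algebra ::
    "('k, 'z) ring_scheme \<Rightarrow> ('k, 'b, 'y) module_scheme \<Rightarrow> bool" where
  "separable_algebra k B \<longleftrightarrow>
     (\<exists>(n::nat) x y. x \<in> {..<n} \<rightarrow> carrier B \<and> y \<in> {..<n} \<rightarrow> carrier B \<and>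
        (\<Oplus>\<^bsub>B\<^esub>i\<in>{..<n}. x i \<otimes>\<^bsub>B\<^esub> y i) = \<one>\<^bsub>B\<^esub> \<and>
        (\<forall>b\<in>carrier B.
           tensor_class (carrier k) B (\<lambda>v c. c \<odot>\<^bsub>B\<^esub> v) B (smult B)
             (\<Sum>i<n. frag_of (b \<otimes>\<^bsub>B\<^esub> x i, y i)) =
           tensor_class (carrier k) B (\<lambda>v c. c \<odot>\<^bsub>B\<^esub> v) B (smult B)
             (\<Sum>i<n. frag_of (x i, y i \<otimes>\<^bsub>B\<^esub> b))))"


section \<open>Differential graded algebras and modules\<close>

text \<open>
  Graded objects are kept as internal direct sums: the carrier is the underlying ungraded
  object, and the homogeneous components are subgroups of it.
\<close>

definition homogeneous_decomposition ::
    "('v, 'z) ring_scheme \<Rightarrow> (int \<Rightarrow> 'v set) \<Rightarrow> 'v \<Rightarrow> (int \<Rightarrow> 'v) \<Rightarrow> bool" where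
  "homogeneous_decomposition G g x c \<longleftrightarrow>
     (\<forall>i. c i \<in> g i) \<and> finite {i. c i \<noteq> \<zero>\<^bsub>G\<^esub>} \<and> x = (\<Oplus>\<^bsub>G\<^esub>i\<in>{i. c i \<noteq> \<zero>\<^bsub>G\<^esub>}. c i)"

definition grading :: "('v, 'z) ring_scheme \<Rightarrow> (int \<Rightarrow> 'v set) \<Rightarrow> bool" where
  "grading G g \<longleftrightarrow> (\<forall>i. additive_subgroup (g i) G) \<and>
     (\<forall>x\<in>carrier G. \<exists>!c. homogeneous_decomposition G g x c)"

text \<open>\<open>(-1)\<^sup>i x\<close>, and its additive extension from homogeneous to arbitrary elements.\<close>

definition sign_by :: "('v, 'z) ring_scheme \<Rightarrow> int \<Rightarrow> 'v \<Rightarrow> 'v" where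
  "sign_by G i x = (if even i then x else \<ominus>\<^bsub>G\<^esub> x)"

definition sign_twist :: "('v, 'z) ring_scheme \<Rightarrow> (int \<Rightarrow> 'v set) \<Rightarrow> 'v \<Rightarrow> 'v" where
  "sign_twist G g x =
     (let c = (THE c. homogeneous_decomposition G g x c)
      in \<Oplus>\<^bsub>G\<^esub>i\<in>{i. c i \<noteq> \<zero>\<^bsub>G\<^esub>}. sign_by G i (c i))"

record ('k, 'a) dga = "('k, 'a) module" +
  alg_gr :: "int \<Rightarrow> 'a set"
  alg_d :: "'a \<Rightarrow> 'a"

locale dg_algebra = field k + assoc_algebra k A
  for k (structure) and A :: "('k, 'a, 'z) dga_scheme" (structure) +
  assumes alg_grading: "grading A (alg_gr A)"
    and alg_gr_subspace: "submodule (alg_gr A i) k A"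
    and alg_one_gr: "\<one>\<^bsub>A\<^esub> \<in> alg_gr A 0"
    and alg_mult_gr: "\<lbrakk>x \<in> alg_gr A i; y \<in> alg_gr A j\<rbrakk> \<Longrightarrow> x \<otimes>\<^bsub>A\<^esub> y \<in> alg_gr A (i + j)"
    and alg_d_gr: "x \<in> alg_gr A i \<Longrightarrow> alg_d A x \<in> alg_gr A (i + 1)"
    and alg_d_closed: "x \<in> carrier A \<Longrightarrow> alg_d A x \<in> carrier A"
    and alg_d_add:
      "\<lbrakk>x \<in> carrier A; y \<in> carrier A\<rbrakk> \<Longrightarrow> alg_d A (x \<oplus>\<^bsub>A\<^esub> y) = alg_d A x \<oplus>\<^bsub>A\<^esub> alg_d A y"
    and alg_d_smult:
      "\<lbrakk>c \<in> carrier k; x \<in> carrier A\<rbrakk> \<Longrightarrow> alg_d A (c \<odot>\<^bsub>A\<^esub> x) = c \<odot>\<^bsub>A\<^esub> alg_d A x"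
    and alg_d_d: "x \<in> carrier A \<Longrightarrow> alg_d A (alg_d A x) = \<zero>\<^bsub>A\<^esub>"
    and alg_Leibniz:
      "\<lbrakk>x \<in> alg_gr A i; y \<in> carrier A\<rbrakk> \<Longrightarrow>
        alg_d A (x \<otimes>\<^bsub>A\<^esub> y) = alg_d A x \<otimes>\<^bsub>A\<^esub> y \<oplus>\<^bsub>A\<^esub> sign_by A i (x \<otimes>\<^bsub>A\<^esub> alg_d A y)"

locale fd_dg_algebra = dg_algebra +
  assumes fd_components: "finite_dim_subspace k A (alg_gr A i)"
    and bounded_components: "\<exists>n. \<forall>i. \<bar>i\<bar> > n \<longrightarrow> alg_gr A i = {\<zero>\<^bsub>A\<^esub>}"

text \<open>
  Right DG modules. No separate \<open>k\<close>-structure is stored: \<open>k\<close> acts through \<open>A\<close>, and the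
  components and the differential of a DG module respect this action, since \<open>k\<close> maps to degree
  zero cocycles of \<open>A\<close>. As in \<^locale>\<open>module\<close>, the fields \<open>mult\<close> and \<open>one\<close> of the underlying
  record are irrelevant.
\<close>

record ('a, 'm) dgmod = "'m ring" +
  ract :: "'m \<Rightarrow> 'a \<Rightarrow> 'm"
  gr :: "int \<Rightarrow> 'm set"
  diff :: "'m \<Rightarrow> 'm"

locale dg_module = abelian_group M
  for A :: "('k, 'a, 'z) dga_scheme" and M :: "('a, 'm, 'y) dgmod_scheme" (structure) +
  assumes ract_closed: "\<lbrakk>x \<in> carrier M; a \<in> carrier A\<rbrakk> \<Longrightarrow> ract M x a \<in> carrier M"
    and ract_add_left:
      "\<lbrakk>x \<in> carrier M; y \<in> carrier M; a \<in> carrier A\<rbrakk> \<Longrightarrow>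
        ract M (x \<oplus>\<^bsub>M\<^esub> y) a = ract M x a \<oplus>\<^bsub>M\<^esub> ract M y a"
    and ract_add_right:
      "\<lbrakk>x \<in> carrier M; a \<in> carrier A; b \<in> carrier A\<rbrakk> \<Longrightarrow>
        ract M x (a \<oplus>\<^bsub>A\<^esub> b) = ract M x a \<oplus>\<^bsub>M\<^esub> ract M x b"
    and ract_mult:
      "\<lbrakk>x \<in> carrier M; a \<in> carrier A; b \<in> carrier A\<rbrakk> \<Longrightarrow>
        ract M x (a \<otimes>\<^bsub>A\<^esub> b) = ract M (ract M x a) b"
    and ract_one: "x \<in> carrier M \<Longrightarrow> ract M x \<one>\<^bsub>A\<^esub> = x"
    and gr_grading: "grading M (gr M)"
    and ract_gr: "\<lbrakk>x \<in> gr M i; a \<in> alg_gr A j\<rbrakk> \<Longrightarrow> ract M x a \<in> gr M (i + j)"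
    and diff_closed: "x \<in> carrier M \<Longrightarrow> diff M x \<in> carrier M"
    and diff_gr: "x \<in> gr M i \<Longrightarrow> diff M x \<in> gr M (i + 1)"
    and diff_add:
      "\<lbrakk>x \<in> carrier M; y \<in> carrier M\<rbrakk> \<Longrightarrow> diff M (x \<oplus>\<^bsub>M\<^esub> y) = diff M x \<oplus>\<^bsub>M\<^esub> diff M y"
    and diff_diff: "x \<in> carrier M \<Longrightarrow> diff M (diff M x) = \<zero>\<^bsub>M\<^esub>"
    and Leibniz:
      "\<lbrakk>x \<in> gr M i; a \<in> carrier A\<rbrakk> \<Longrightarrow>
        diff M (ract M x a) = ract M (diff M x) a \<oplus>\<^bsub>M\<^esub> sign_by M i (ract M x (alg_d A a))"

definition zero_dgmod :: "('a, 'm) dgmod" where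
  "zero_dgmod =
     \<lparr>carrier = {undefined}, monoid.mult = (\<lambda>_ _. undefined), one = undefined, ring.zero = undefined,
      ring.add = (\<lambda>_ _. undefined), ract = (\<lambda>_ _. undefined), gr = (\<lambda>_. {undefined}),
      diff = (\<lambda>_. undefined)\<rparr>"


section \<open>The derived category\<close>

definition dg_hom ::
    "('k, 'a, 'z) dga_scheme \<Rightarrow> ('a, 'm, 'y) dgmod_scheme \<Rightarrow> ('a, 'n, 'x) dgmod_scheme
      \<Rightarrow> ('m \<Rightarrow> 'n) set" where
  "dg_hom A M N = {f \<in> carrier M \<rightarrow> carrier N.
     (\<forall>x\<in>carrier M. \<forall>y\<in>carrier M. f (x \<oplus>\<^bsub>M\<^esub> y) = f x \<oplus>\<^bsub>N\<^esub> f y) \<and>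
     (\<forall>x\<in>carrier M. \<forall>a\<in>carrier A. f (ract M x a) = ract N (f x) a) \<and>
     (\<forall>i. \<forall>x\<in>gr M i. f x \<in> gr N i) \<and>
     (\<forall>x\<in>carrier M. f (diff M x) = diff N (f x))}"

definition cocycles :: "('a, 'm, 'y) dgmod_scheme \<Rightarrow> int \<Rightarrow> 'm set" where
  "cocycles M i = {x \<in> gr M i. diff M x = \<zero>\<^bsub>M\<^esub>}"

definition coboundaries :: "('a, 'm, 'y) dgmod_scheme \<Rightarrow> int \<Rightarrow> 'm set" where
  "coboundaries M i = diff M ` gr M (i - 1)"

definition cohomology :: "('a, 'm, 'y) dgmod_scheme \<Rightarrow> int \<Rightarrow> 'm set set" where
  "cohomology M i = (\<lambda>x. coboundaries M i +>\<^bsub>M\<^esub> x) ` cocycles M i"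

definition cohomology_map ::
    "('a, 'n, 'x) dgmod_scheme \<Rightarrow> ('m \<Rightarrow> 'n) \<Rightarrow> int \<Rightarrow> 'm set \<Rightarrow> 'n set" where
  "cohomology_map N f i C = (\<Union>x\<in>C. coboundaries N i +>\<^bsub>N\<^esub> f x)"

definition quasi_iso ::
    "('k, 'a, 'z) dga_scheme \<Rightarrow> ('a, 'm, 'y) dgmod_scheme \<Rightarrow> ('a, 'n, 'x) dgmod_scheme
      \<Rightarrow> ('m \<Rightarrow> 'n) \<Rightarrow> bool" where
  "quasi_iso A M N f \<longleftrightarrow> f \<in> dg_hom A M N \<and>
     (\<forall>i. bij_betw (cohomology_map N f i) (cohomology M i) (cohomology N i))"

text \<open>
  Isomorphism in \<open>\<D>(A)\<close>, the localisation of right DG \<open>A\<close>-modules at the quasi-isomorphisms: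
  \<open>M\<close> and \<open>N\<close> are joined by a finite zigzag of quasi-isomorphisms. The intermediate modules
  live on the same type as \<open>M\<close> and \<open>N\<close>; for \<open>N = 0\<close> this is no restriction, as then
  the single map \<open>M \<rightarrow> 0\<close> is a quasi-isomorphism.
\<close>

definition derived_iso ::
    "('k, 'a, 'z) dga_scheme \<Rightarrow> ('a, 'm) dgmod \<Rightarrow> ('a, 'm) dgmod \<Rightarrow> bool" where
  "derived_iso A = equivclp (\<lambda>M N. dg_module A M \<and> dg_module A N \<and> (\<exists>f. quasi_iso A M N f))"


section \<open>The derived tensor product\<close>

text \<open>DG bimodules are right DG modules with an additional left action.\<close>

record ('a, 'm) dgbimod = "('a, 'm) dgmod" +
  lact :: "'a \<Rightarrow> 'm \<Rightarrow> 'm"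

text \<open>
  \<open>A/I\<close> as a DG bimodule over \<open>A\<close>, for a two-sided DG ideal \<open>I\<close>: both actions are
  multiplication in \<open>A/I\<close> after the projection \<open>A \<rightarrow> A/I\<close>.
\<close>

definition quotient_dgbimod :: "('k, 'a, 'z) dga_scheme \<Rightarrow> 'a set \<Rightarrow> ('a, 'a set) dgbimod" where
  "quotient_dgbimod A I =
     \<lparr>carrier = carrier (A Quot I), monoid.mult = monoid.mult (A Quot I), one = one (A Quot I),
      ring.zero = ring.zero (A Quot I), ring.add = ring.add (A Quot I),
      ract = (\<lambda>C a. C \<otimes>\<^bsub>A Quot I\<^esub> (I +>\<^bsub>A\<^esub> a)),
      gr = (\<lambda>i. (\<lambda>x. I +>\<^bsub>A\<^esub> x) ` alg_gr A i),
      diff = (\<lambda>C. \<Union>x\<in>C. I +>\<^bsub>A\<^esub> alg_d A x),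
      lact = (\<lambda>a C. (I +>\<^bsub>A\<^esub> a) \<otimes>\<^bsub>A Quot I\<^esub> C)\<rparr>"

definition J_minus :: "('k, 'a, 'z) dga_scheme \<Rightarrow> 'a set" where
  "J_minus A = {r \<in> jacobson_radical A. alg_d A r \<in> jacobson_radical A}"

text \<open>
  \<open>P \<otimes>\<^sub>A B\<close> as a right DG module, with \<open>(x \<otimes> b) a = x \<otimes> b a\<close> and
  \<open>d (x \<otimes> b) = d x \<otimes> b + (-1)\<^bsup>deg x\<^esup> x \<otimes> d b\<close>. An additive map on the free abelian group is
  applied to a coset by applying it to all representatives.
\<close>

definition dg_tensor ::
    "('k, 'a, 'z) dga_scheme \<Rightarrow> ('a, 'p) dgmod \<Rightarrow> ('a, 'b) dgbimod
      \<Rightarrow> ('a, ('p \<times> 'b \<Rightarrow>\<^sub>0 int) set) dgmod" where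
  "dg_tensor A P B =
     (let T = tensor_group (carrier A) P (ract P) B (lact B);
          cls = tensor_class (carrier A) P (ract P) B (lact B)
      in \<lparr>carrier = carrier T, monoid.mult = (\<lambda>_ _. undefined), one = undefined,
          ring.zero = one T, ring.add = monoid.mult T,
          ract = (\<lambda>C a. \<Union>u\<in>C. cls (frag_extend (\<lambda>(x, b). frag_of (x, ract B b a)) u)),
          gr = (\<lambda>n. generate T {cls (frag_of (x, b)) | x b.
                  \<exists>i j. i + j = n \<and> x \<in> gr P i \<and> b \<in> gr B j}),
          diff = (\<lambda>C. \<Union>u\<in>C. cls (frag_extend
                  (\<lambda>(x, b). frag_of (diff P x, b) + frag_of (sign_twist P (gr P) x, diff B b)) u))\<rparr>)"

definition lin_comb ::
    "('k, 'a, 'z) dga_scheme \<Rightarrow> ('a, 'p, 'y) dgmod_scheme \<Rightarrow> 'p set \<Rightarrow> ('p \<Rightarrow> 'a) \<Rightarrow> 'p \<Rightarrow> bool" where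
  "lin_comb A P E c x \<longleftrightarrow>
     (\<forall>e\<in>E. c e \<in> carrier A) \<and> (\<forall>e. e \<notin> E \<longrightarrow> c e = \<zero>\<^bsub>A\<^esub>) \<and> finite {e. c e \<noteq> \<zero>\<^bsub>A\<^esub>} \<and>
     x = (\<Oplus>\<^bsub>P\<^esub>e\<in>{e. c e \<noteq> \<zero>\<^bsub>A\<^esub>}. ract P e (c e))"

text \<open>
  Semi-free DG modules, i.e. those with an exhaustive filtration \<open>0 = F\<^sub>-\<^sub>1 \<subseteq> F\<^sub>0 \<subseteq> F\<^sub>1 \<subseteq> \<dots>\<close> by DG
  submodules whose subquotients are direct sums of shifts of \<open>A\<close>. The filtration is given through
  a homogeneous basis \<open>E\<close> of the underlying module and a rank function on it: \<open>F\<^sub>n\<close> is spanned by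
  the basis elements of rank at most \<open>n\<close>, and the differential of a basis element is a
  combination of basis elements of smaller rank.
\<close>

definition semifree :: "('k, 'a, 'z) dga_scheme \<Rightarrow> ('a, 'p) dgmod \<Rightarrow> bool" where
  "semifree A P \<longleftrightarrow> dg_module A P \<and>
     (\<exists>E (\<rho> :: 'p \<Rightarrow> nat). E \<subseteq> (\<Union>i. gr P i) \<and>
        (\<forall>x\<in>carrier P. \<exists>!c. lin_comb A P E c x) \<and>
        (\<forall>e\<in>E. \<exists>c. lin_comb A P {e' \<in> E. \<rho> e' < \<rho> e} c (diff P e)))"

text \<open>
  \<open>T\<close> represents \<open>M \<otimes>\<^sub>A\<^sup>L B\<close>: it is \<open>P \<otimes>\<^sub>A B\<close> for a semi-free resolution \<open>P \<rightarrow> M\<close>. The derived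
  tensor product is only determined up to isomorphism in \<open>\<D>(A)\<close>, hence a relation. Every \<open>M\<close> has
  a semi-free resolution, on a type \<open>'p\<close> that is in general larger than the type of \<open>M\<close>.
\<close>

definition derived_tensor ::
    "('k, 'a, 'z) dga_scheme \<Rightarrow> ('a, 'm) dgmod \<Rightarrow> ('a, 'b) dgbimod
      \<Rightarrow> ('a, ('p \<times> 'b \<Rightarrow>\<^sub>0 int) set) dgmod \<Rightarrow> bool" where
  "derived_tensor A M B T \<longleftrightarrow>
     (\<exists>(P :: ('a, 'p) dgmod) q. semifree A P \<and> quasi_iso A P M q \<and> T = dg_tensor A P B)"

end

theory Submission
  imports Defs
begin

text \<open>
  Write \<open>I\<close> for the nilpotent DG ideal \<open>J\<^sub>-\<close> and let \<open>P \<rightarrow> M\<close> be a semi-free resolution. The hypothesis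
  says that \<open>P \<otimes>\<^sub>A A/I = P/PI\<close> is acyclic. By induction on the rank of the basis elements one builds
  an \<open>A\<close>-linear map \<open>h\<close> of degree \<open>-1\<close> on \<open>P\<close> which is a contraction modulo \<open>PI\<close>, i.e.
  \<open>f = 1 - (d h + h d)\<close> maps \<open>P\<close> to \<open>PI\<close>. As \<open>f\<close> is \<open>A\<close>-linear, it maps \<open>PI\<^sup>m\<close> to \<open>PI\<^sup>m\<^sup>+\<^sup>1\<close>; since \<open>x - f x = d (h x)\<close>
  for a cocycle \<open>x\<close>, every cocycle is modulo coboundaries in \<open>PI\<^sup>m\<close> for all \<open>m\<close>, hence a coboundary.
\<close>

text \<open>An acyclic DG module need not be contractible. Semi-freeness makes up for this:
  \<open>d e\<close> involves only basis elements of rank smaller than that of \<open>e\<close>, so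
  \<open>h\<close> can be chosen one basis element at a time, each choice being possible by
  acyclicity of \<open>P/PI\<close>. The resulting \<open>h\<close> contracts \<open>P\<close> only
  modulo \<open>PI\<close>, but \<open>f\<close> is homotopic to the identity and, \<open>I\<close>
  being nilpotent, some power of \<open>f\<close> is zero. Linearity of \<open>f\<close> is a matter
  of signs: \<open>h\<close> lowers the degree by one, so the two Leibniz terms containing
  \<open>d a\<close> cancel. Nilpotency of \<open>I\<close> is inherited from the Jacobson radical.
  That radical belongs to the ungraded algebra, so its elements need not be homogeneous; the sign
  automorphism of \<open>A\<close> takes care of them in the Leibniz rule. The quotient
  \<open>P/PI\<close> is never formed. Everything is a congruence modulo \<open>PI\<close>, and
  tensors are compared with elements of \<open>P\<close> by sending \<open>x\<close> tensor
  \<open>b\<close> to \<open>x\<close> times a chosen representative of \<open>b\<close>, which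
  respects the tensor relations only modulo \<open>PI\<close>.\<close>

section \<open>Additive maps and additive subgroups\<close>

lemma (in abelian_monoid) finsum_mem:
  assumes "H \<subseteq> carrier G" "\<zero> \<in> H" "\<And>x y. x \<in> H \<Longrightarrow> y \<in> H \<Longrightarrow> x \<oplus> y \<in> H"
    and "\<And>i. i \<in> F \<Longrightarrow> f i \<in> H"
  shows "(\<Oplus>i\<in>F. f i) \<in> H"
  using assms(4)
proof (induction F rule: infinite_finite_induct)
  case (insert a F)
  then have "f \<in> F \<rightarrow> carrier G" "f a \<in> carrier G"
    using assms(1) by auto
  then show ?case
    using insert assms(3) by (simp add: finsum_insert)
qed (auto simp: assms finsum_infinite)

lemma additive_zero:
  assumes "abelian_group G" "abelian_group H" "f \<in> hom (add_monoid G) (add_monoid H)"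
  shows "f \<zero>\<^bsub>G\<^esub> = \<zero>\<^bsub>H\<^esub>"
  using hom_one[OF assms(3)] abelian_group.a_group[OF assms(1)] abelian_group.a_group[OF assms(2)]
  by simp

lemma additive_minus:
  assumes "abelian_group G" "abelian_group H" "f \<in> hom (add_monoid G) (add_monoid H)"
    and "x \<in> carrier G"
  shows "f (\<ominus>\<^bsub>G\<^esub> x) = \<ominus>\<^bsub>H\<^esub> f x"
proof -
  interpret group_hom "add_monoid G" "add_monoid H" f
    using assms by (simp add: group_hom_def group_hom_axioms_def abelian_group.a_group)
  show ?thesis
    using hom_inv[of x] assms(4) by (simp add: a_inv_def)
qed

lemma additive_finsum:
  assumes "abelian_group G" "abelian_group H" "f \<in> hom (add_monoid G) (add_monoid H)"
    and "\<And>i. i \<in> F \<Longrightarrow> g i \<in> carrier G"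
  shows "f (\<Oplus>\<^bsub>G\<^esub>i\<in>F. g i) = (\<Oplus>\<^bsub>H\<^esub>i\<in>F. f (g i))"
proof -
  interpret G: abelian_group G by fact
  interpret H: abelian_group H by fact
  have f: "f x \<in> carrier H" if "x \<in> carrier G" for x
    using hom_in_carrier[OF assms(3)] that by simp
  have add: "f (x \<oplus>\<^bsub>G\<^esub> y) = f x \<oplus>\<^bsub>H\<^esub> f y" if "x \<in> carrier G" "y \<in> carrier G" for x y
    using hom_mult[OF assms(3)] that by simp
  show ?thesis using assms(4)
  proof (induction F rule: infinite_finite_induct)
    case (insert a F)
    then have "g \<in> F \<rightarrow> carrier G" "g a \<in> carrier G" by auto
    moreover from this have "(\<lambda>i. f (g i)) \<in> F \<rightarrow> carrier H" "f (g a) \<in> carrier H"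
      using f by auto
    ultimately show ?case
      using insert by (simp add: add)
  qed (auto simp: additive_zero[OF assms(1-3)] G.finsum_infinite H.finsum_infinite)
qed

lemma (in abelian_group) a_inv_zero [simp]: "\<ominus> \<zero> = \<zero>"
  by (rule minus_equality) simp_all

lemma (in abelian_group) add_minus_add_cancel:
  assumes "p \<in> carrier G" "q \<in> carrier G" "r \<in> carrier G"
  shows "(p \<oplus> q) \<ominus> (p \<oplus> r) = q \<ominus> r"
proof -
  have "(p \<oplus> q) \<ominus> (p \<oplus> r) = (p \<oplus> \<ominus> p) \<oplus> (q \<oplus> \<ominus> r)"
    using assms by (simp add: minus_eq minus_add a_ac)
  then show ?thesis using assms by (simp add: r_neg minus_eq)
qed

lemma (in abelian_group) additive_subgroup_iff:
  "additive_subgroup H G \<longleftrightarrow> H \<subseteq> carrier G \<and> \<zero> \<in> H \<and> (\<forall>x\<in>H. \<forall>y\<in>H. x \<oplus> y \<in> H) \<and> (\<forall>x\<in>H. \<ominus> x \<in> H)"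
proof
  assume "additive_subgroup H G"
  then interpret additive_subgroup H G .
  show "H \<subseteq> carrier G \<and> \<zero> \<in> H \<and> (\<forall>x\<in>H. \<forall>y\<in>H. x \<oplus> y \<in> H) \<and> (\<forall>x\<in>H. \<ominus> x \<in> H)"
    using a_subset a_inv_closed abelian_group_axioms by auto
next
  assume "H \<subseteq> carrier G \<and> \<zero> \<in> H \<and> (\<forall>x\<in>H. \<forall>y\<in>H. x \<oplus> y \<in> H) \<and> (\<forall>x\<in>H. \<ominus> x \<in> H)"
  then show "additive_subgroup H G"
    by (intro additive_subgroupI add.subgroupI) auto
qed


section \<open>The Jacobson radical\<close>

text \<open>Negatives come for free, because \<open>\<ominus> x\<close> is \<open>x\<close> times
  \<open>\<ominus> \<one>\<close>. This shortens the checks for the right ideals constructed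
  below.\<close>

lemma (in ring) right_ideal_iff:
  "right_ideal R K \<longleftrightarrow> K \<subseteq> carrier R \<and> \<zero> \<in> K \<and> (\<forall>x\<in>K. \<forall>y\<in>K. x \<oplus> y \<in> K) \<and>
     (\<forall>x\<in>K. \<forall>a\<in>carrier R. x \<otimes> a \<in> K)"
proof -
  have "\<ominus> x \<in> K" if "K \<subseteq> carrier R" "x \<in> K" "\<forall>x\<in>K. \<forall>a\<in>carrier R. x \<otimes> a \<in> K" for x
  proof -
    have "x \<otimes> (\<ominus> \<one>) = \<ominus> x" using that by (auto simp: r_minus subset_iff)
    then show ?thesis using that by (metis add.inv_closed one_closed)
  qed
  then show ?thesis
    unfolding right_ideal_def additive_subgroup_iff by blast
qed

lemma (in ring) jacobson_radical_carrier: "jacobson_radical R \<subseteq> carrier R"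
  by (auto simp: jacobson_radical_def)

lemma (in ring) right_ideal_jacobson_radical: "right_ideal R (jacobson_radical R)"
  unfolding right_ideal_iff jacobson_radical_def maximal_right_ideal_def by auto

text \<open>The right module \<open>V/W\<close> is simple or zero, and the radical annihilates such
  modules: the annihilator \<open>K\<close> of the class of \<open>v\<close> is either the whole
  ring or a maximal right ideal, and contains \<open>x\<close> in both cases. Speaking of right
  ideals between \<open>W\<close> and \<open>V\<close> avoids the quotient.\<close>

lemma (in ring) simple_quotient_jacobson:
  assumes V: "right_ideal R V" and W: "right_ideal R W" "W \<subseteq> V"
    and simple: "\<And>U. \<lbrakk>right_ideal R U; W \<subseteq> U; U \<subseteq> V\<rbrakk> \<Longrightarrow> U = W \<or> U = V"
    and v: "v \<in> V" and x: "x \<in> jacobson_radical R"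
  shows "v \<otimes> x \<in> W"
proof -
  define K where "K = {a \<in> carrier R. v \<otimes> a \<in> W}"
  have vR: "v \<in> carrier R" and xR: "x \<in> carrier R"
    using V v x jacobson_radical_carrier by (auto simp: right_ideal_iff)
  have VR: "V \<subseteq> carrier R" and WR: "W \<subseteq> carrier R"
    using V W by (auto simp: right_ideal_iff)
  have K: "right_ideal R K"
    using W vR unfolding right_ideal_iff K_def
    by (auto simp: r_distr subset_iff m_assoc[symmetric])
  show ?thesis
  proof (cases "K = carrier R")
    case True
    then show ?thesis using xR by (auto simp: K_def)
  next
    case False
    have "maximal_right_ideal R K"
      unfolding maximal_right_ideal_def
    proof (intro conjI K False allI impI)
      fix L assume L: "right_ideal R L \<and> K \<subseteq> L"
      then have LR: "L \<subseteq> carrier R" by (auto simp: right_ideal_iff)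
      show "L = K \<or> L = carrier R"
      proof (cases "L = K")
        case False
        then obtain l where l: "l \<in> L" "v \<otimes> l \<notin> W" "l \<in> carrier R"
          using L LR by (auto simp: K_def)
        \<comment> \<open>This is \<open>W\<close> plus the right ideal generated by
          \<open>v l\<close>. As \<open>v l\<close> is not in \<open>W\<close>, simplicity makes it
          all of \<open>V\<close>. Writing \<open>v a\<close> in this form puts
          \<open>a - l b\<close> into \<open>K\<close>, hence \<open>a\<close> into
          \<open>L\<close>.\<close>
        define U where "U = {w \<oplus> v \<otimes> l \<otimes> a | w a. w \<in> W \<and> a \<in> carrier R}"
        have "right_ideal R U"
          unfolding right_ideal_iff
        proof (intro conjI ballI)
          show "U \<subseteq> carrier R" using WR vR l by (auto simp: U_def)
          show "\<zero> \<in> U"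
            using W vR l by (auto simp: U_def right_ideal_iff intro!: exI[of _ \<zero>])
        next
          fix p q assume "p \<in> U" "q \<in> U"
          then obtain w a w' a' where *: "p = w \<oplus> v \<otimes> l \<otimes> a" "q = w' \<oplus> v \<otimes> l \<otimes> a'"
            "w \<in> W" "w' \<in> W" "a \<in> carrier R" "a' \<in> carrier R"
            by (auto simp: U_def)
          then have "w \<in> carrier R" "w' \<in> carrier R" using WR by auto
          then have "p \<oplus> q = (w \<oplus> w') \<oplus> v \<otimes> l \<otimes> (a \<oplus> a')"
            using * vR l by (simp add: r_distr a_ac)
          moreover have "w \<oplus> w' \<in> W" using * W by (auto simp: right_ideal_iff)
          ultimately show "p \<oplus> q \<in> U" using * by (auto simp: U_def)
        next
          fix p b assume "p \<in> U" and b: "b \<in> carrier R"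
          then obtain w a where *: "p = w \<oplus> v \<otimes> l \<otimes> a" "w \<in> W" "a \<in> carrier R"
            by (auto simp: U_def)
          then have "w \<in> carrier R" using WR by auto
          then have "p \<otimes> b = (w \<otimes> b) \<oplus> v \<otimes> l \<otimes> (a \<otimes> b)"
            using * vR l b by (simp add: l_distr m_assoc)
          moreover have "w \<otimes> b \<in> W" using * b W by (auto simp: right_ideal_iff)
          ultimately show "p \<otimes> b \<in> U" using * b by (auto simp: U_def)
        qed
        moreover have "W \<subseteq> U"
        proof
          fix w assume w: "w \<in> W"
          then have "w = w \<oplus> v \<otimes> l \<otimes> \<zero>" using WR vR l by auto
          then show "w \<in> U" using w unfolding U_def by blast
        qed
        moreover have "U \<subseteq> V"
          using W V v l by (auto simp: U_def right_ideal_iff)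
        moreover have "v \<otimes> l \<in> U"
        proof -
        have "v \<otimes> l = \<zero> \<oplus> v \<otimes> l \<otimes> \<one>" "\<zero> \<in> W" using W vR l by (auto simp: right_ideal_iff)
        then show ?thesis unfolding U_def by blast
      qed
        ultimately have "U = V" using simple l by blast
        have "a \<in> L" if a: "a \<in> carrier R" for a
        proof -
          have "v \<otimes> a \<in> U" using V v a \<open>U = V\<close> by (auto simp: right_ideal_iff)
          then obtain w b where *: "v \<otimes> a = w \<oplus> v \<otimes> l \<otimes> b" "w \<in> W" "b \<in> carrier R"
            by (auto simp: U_def)
          then have wR: "w \<in> carrier R" using WR by auto
          have "v \<otimes> (a \<ominus> l \<otimes> b) = v \<otimes> a \<ominus> v \<otimes> l \<otimes> b"
            using vR a l *(3) by (simp add: minus_eq r_distr r_minus m_assoc)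
          also have "\<dots> = w" unfolding *(1) using wR vR l *(3)
            by (simp add: minus_eq a_assoc r_neg)
          finally have "a \<ominus> l \<otimes> b \<in> K" using * a l by (simp add: K_def)
          then have "(a \<ominus> l \<otimes> b) \<oplus> l \<otimes> b \<in> L"
            using L l * by (auto simp: right_ideal_iff)
          then show ?thesis using a l * by (simp add: minus_eq a_assoc l_neg)
        qed
        then show ?thesis using LR by auto
      qed simp
    qed
    then have "x \<in> K" using x by (auto simp: jacobson_radical_def)
    then show ?thesis by (simp add: K_def)
  qed
qed

text \<open>The radical is defined through right ideals, so multiplication from the left needs an
  argument: for a maximal right ideal \<open>K\<close> the module \<open>R/K\<close> is simple, and
  \<open>x\<close> annihilates the class of \<open>a\<close> in it.\<close>

lemma (in ring) jacobson_radical_left: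
  assumes "a \<in> carrier R" "x \<in> jacobson_radical R"
  shows "a \<otimes> x \<in> jacobson_radical R"
proof -
  have xR: "x \<in> carrier R" using assms jacobson_radical_carrier by auto
  have "a \<otimes> x \<in> K" if K: "maximal_right_ideal R K" for K
  proof (rule simple_quotient_jacobson[of "carrier R"])
    show "right_ideal R (carrier R)" by (auto simp: right_ideal_iff)
    show "right_ideal R K" "K \<subseteq> carrier R"
      using K by (auto simp: maximal_right_ideal_def right_ideal_iff)
    show "U = K \<or> U = carrier R" if "right_ideal R U" "K \<subseteq> U" for U
      using K that by (auto simp: maximal_right_ideal_def)
  qed (use assms in auto)
  then show ?thesis using assms(1) xR by (simp add: jacobson_radical_def)
qed

section \<open>Nilpotency of the radical by counting pivots\<close>

primrec k_span :: "('k, 'z) ring_scheme \<Rightarrow> ('k, 'v, 'y) module_scheme \<Rightarrow> 'v list \<Rightarrow> 'v set" where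
  "k_span k V [] = {\<zero>\<^bsub>V\<^esub>}"
| "k_span k V (b # bs) = {c \<odot>\<^bsub>V\<^esub> b \<oplus>\<^bsub>V\<^esub> y | c y. c \<in> carrier k \<and> y \<in> k_span k V bs}"

text \<open>
  The number of pivots of a subspace \<open>W\<close> with respect to the flag spanned by the tails of \<open>bs\<close>; it
  stands in for the dimension of \<open>W\<close>.
\<close>

primrec pivots ::
    "('k, 'z) ring_scheme \<Rightarrow> ('k, 'v, 'y) module_scheme \<Rightarrow> 'v set \<Rightarrow> 'v list \<Rightarrow> nat" where
  "pivots k V W [] = 0"
| "pivots k V W (b # bs) =
     pivots k V W bs + (if \<exists>y\<in>k_span k V bs. b \<oplus>\<^bsub>V\<^esub> y \<in> W then 1 else 0)"

lemma (in module) submodule_k_span: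
  "set bs \<subseteq> carrier M \<Longrightarrow> submodule (k_span R M bs) R M"
proof (induction bs)
  case Nil
  then show ?case by (auto intro!: submoduleI)
next
  case (Cons b bs)
  then interpret W: submodule "k_span R M bs" R M by auto
  have b: "b \<in> carrier M" using Cons by auto
  have W: "k_span R M bs \<subseteq> carrier M" "\<zero>\<^bsub>M\<^esub> \<in> k_span R M bs"
    "\<And>x y. \<lbrakk>x \<in> k_span R M bs; y \<in> k_span R M bs\<rbrakk> \<Longrightarrow> x \<oplus>\<^bsub>M\<^esub> y \<in> k_span R M bs"
    "\<And>x. x \<in> k_span R M bs \<Longrightarrow> \<ominus>\<^bsub>M\<^esub> x \<in> k_span R M bs"
    "\<And>c x. \<lbrakk>c \<in> carrier R; x \<in> k_span R M bs\<rbrakk> \<Longrightarrow> c \<odot>\<^bsub>M\<^esub> x \<in> k_span R M bs"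
    using submoduleE[OF W.submodule_axioms] W.smult_closed W.one_closed by auto
  show ?case
  proof (rule submoduleI)
    show "k_span R M (b # bs) \<subseteq> carrier M" using b W by auto
    show "\<zero>\<^bsub>M\<^esub> \<in> k_span R M (b # bs)"
      using b W by (auto intro!: exI[of _ \<zero>] exI[of _ "\<zero>\<^bsub>M\<^esub>"])
  next
    fix x assume "x \<in> k_span R M (b # bs)"
    then obtain c y where *: "x = c \<odot>\<^bsub>M\<^esub> b \<oplus>\<^bsub>M\<^esub> y" "c \<in> carrier R" "y \<in> k_span R M bs" by auto
    have "\<ominus>\<^bsub>M\<^esub> x = (\<ominus> c) \<odot>\<^bsub>M\<^esub> b \<oplus>\<^bsub>M\<^esub> (\<ominus>\<^bsub>M\<^esub> y)"
      using * b W by (auto simp: M.minus_add smult_l_minus subset_iff)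
    moreover have "\<ominus> c \<in> carrier R" "\<ominus>\<^bsub>M\<^esub> y \<in> k_span R M bs" using * W by auto
    ultimately show "\<ominus>\<^bsub>M\<^esub> x \<in> k_span R M (b # bs)" by auto
  next
    fix x x' assume "x \<in> k_span R M (b # bs)" "x' \<in> k_span R M (b # bs)"
    then obtain c y c' y' where *: "x = c \<odot>\<^bsub>M\<^esub> b \<oplus>\<^bsub>M\<^esub> y" "c \<in> carrier R" "y \<in> k_span R M bs"
      "x' = c' \<odot>\<^bsub>M\<^esub> b \<oplus>\<^bsub>M\<^esub> y'" "c' \<in> carrier R" "y' \<in> k_span R M bs" by auto
    then have "y \<in> carrier M" "y' \<in> carrier M" using W by auto
    then have "x \<oplus>\<^bsub>M\<^esub> x' = (c \<oplus> c') \<odot>\<^bsub>M\<^esub> b \<oplus>\<^bsub>M\<^esub> (y \<oplus>\<^bsub>M\<^esub> y')"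
      using * b by (simp add: smult_l_distr M.a_ac)
    moreover have "c \<oplus> c' \<in> carrier R" "y \<oplus>\<^bsub>M\<^esub> y' \<in> k_span R M bs" using * W by auto
    ultimately show "x \<oplus>\<^bsub>M\<^esub> x' \<in> k_span R M (b # bs)" by auto
  next
    fix a x assume a: "a \<in> carrier R" and "x \<in> k_span R M (b # bs)"
    then obtain c y where *: "x = c \<odot>\<^bsub>M\<^esub> b \<oplus>\<^bsub>M\<^esub> y" "c \<in> carrier R" "y \<in> k_span R M bs" by auto
    then have "y \<in> carrier M" using W by auto
    then have "a \<odot>\<^bsub>M\<^esub> x = (a \<otimes> c) \<odot>\<^bsub>M\<^esub> b \<oplus>\<^bsub>M\<^esub> a \<odot>\<^bsub>M\<^esub> y"
      using * a b by (simp add: smult_r_distr smult_assoc1)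
    moreover have "a \<otimes> c \<in> carrier R" "a \<odot>\<^bsub>M\<^esub> y \<in> k_span R M bs" using * a W by auto
    ultimately show "a \<odot>\<^bsub>M\<^esub> x \<in> k_span R M (b # bs)" by auto
  qed
qed

lemma (in module) k_span_subset:
  assumes "set bs \<subseteq> carrier M" shows "k_span R M bs \<subseteq> carrier M"
  using submoduleE(1)[OF submodule_k_span[OF assms]] .

lemma (in module) set_subset_k_span:
  "set bs \<subseteq> carrier M \<Longrightarrow> set bs \<subseteq> k_span R M bs"
proof (induction bs)
  case (Cons b bs)
  interpret W: submodule "k_span R M bs" R M using Cons submodule_k_span by auto
  have z: "\<zero>\<^bsub>M\<^esub> \<in> k_span R M bs" using W.one_closed by simp
  have "b \<in> k_span R M (b # bs)"
    using Cons.prems z by (auto intro!: exI[of _ \<one>] exI[of _ "\<zero>\<^bsub>M\<^esub>"])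
  moreover have "k_span R M bs \<subseteq> k_span R M (b # bs)"
  proof
    fix y assume y: "y \<in> k_span R M bs"
    then have "y \<in> carrier M" using k_span_subset Cons.prems by auto
    then show "y \<in> k_span R M (b # bs)"
      using Cons.prems y by (auto intro!: exI[of _ \<zero>] exI[of _ y])
  qed
  ultimately show ?case using Cons by auto
qed simp

lemma pivots_mono: "V \<subseteq> W \<Longrightarrow> pivots k M V bs \<le> pivots k M W bs"
  by (induction bs) (auto simp: subset_iff)

text \<open>Gaussian elimination. If \<open>w\<close> in \<open>W\<close> has a non-zero coefficient
  \<open>c\<close> at \<open>b\<close>, equality of the counts provides a vector of \<open>V\<close>
  with leading term \<open>b\<close>; subtracting \<open>c\<close> times this vector leaves an
  element of \<open>W\<close> in the span of the shorter list, where induction applies. Linear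
  dependencies in the list do no harm: a vector that depends on its successors counts as a pivot for
  every subspace.\<close>

lemma pivots_eq_imp_subset:
  assumes "field k" "module k M"
    and V: "submodule V k M" and W: "submodule W k M" and "V \<subseteq> W"
    and "set bs \<subseteq> carrier M" "pivots k M V bs = pivots k M W bs"
  shows "W \<inter> k_span k M bs \<subseteq> V"
  using assms(6,7)
proof (induction bs)
  case Nil
  interpret V: submodule V k M by fact
  show ?case using V.one_closed by auto
next
  case (Cons b bs)
  interpret field k by fact
  interpret module k M by fact
  note subV = submoduleE[OF V] and subW = submoduleE[OF W]
  \<comment> \<open>The count for the tail and the indicator for \<open>b\<close> can only grow from
    \<open>V\<close> to \<open>W\<close>, so equality of the sums forces equality of both
    summands.\<close>
  have le: "pivots k M V bs \<le> pivots k M W bs" using pivots_mono[OF \<open>V \<subseteq> W\<close>] .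
  have "(\<exists>y\<in>k_span k M bs. b \<oplus>\<^bsub>M\<^esub> y \<in> V) \<Longrightarrow> (\<exists>y\<in>k_span k M bs. b \<oplus>\<^bsub>M\<^esub> y \<in> W)"
    using \<open>V \<subseteq> W\<close> by auto
  with Cons.prems(2) le have eq: "pivots k M V bs = pivots k M W bs"
    and iff: "(\<exists>y\<in>k_span k M bs. b \<oplus>\<^bsub>M\<^esub> y \<in> V) \<longleftrightarrow> (\<exists>y\<in>k_span k M bs. b \<oplus>\<^bsub>M\<^esub> y \<in> W)"
    by (auto split: if_splits)
  have IH: "W \<inter> k_span k M bs \<subseteq> V" using Cons eq by auto
  have bs: "set bs \<subseteq> carrier M" and b: "b \<in> carrier M" using Cons.prems by auto
  note subS = submoduleE[OF submodule_k_span[OF bs]]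
  show ?case
  proof
    fix w assume w: "w \<in> W \<inter> k_span k M (b # bs)"
    then obtain c y where *: "w = c \<odot>\<^bsub>M\<^esub> b \<oplus>\<^bsub>M\<^esub> y" "c \<in> carrier k" "y \<in> k_span k M bs" by auto
    have y: "y \<in> carrier M" using * subS by auto
    show "w \<in> V"
    proof (cases "c = \<zero>\<^bsub>k\<^esub>")
      case True
      then have "w = y" using * b y by simp
      then show ?thesis using IH w * by auto
    next
      case False
      then have "c \<in> Units k" using * field_Units by auto
      then obtain c' where c': "c' \<in> carrier k" "c' \<otimes>\<^bsub>k\<^esub> c = \<one>\<^bsub>k\<^esub>" "c \<otimes>\<^bsub>k\<^esub> c' = \<one>\<^bsub>k\<^esub>"
        by (auto simp: Units_def)
      have "c' \<odot>\<^bsub>M\<^esub> w = b \<oplus>\<^bsub>M\<^esub> c' \<odot>\<^bsub>M\<^esub> y"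
        using * c' b y by (simp add: smult_r_distr smult_assoc1[symmetric])
      moreover have "c' \<odot>\<^bsub>M\<^esub> w \<in> W" using w c' subW by auto
      moreover have "c' \<odot>\<^bsub>M\<^esub> y \<in> k_span k M bs" using * c' subS by auto
      ultimately obtain y' where y': "y' \<in> k_span k M bs" "b \<oplus>\<^bsub>M\<^esub> y' \<in> V"
        using iff by metis
      have y'M: "y' \<in> carrier M" using y' subS by auto
      have cv: "c \<odot>\<^bsub>M\<^esub> (b \<oplus>\<^bsub>M\<^esub> y') \<in> V" using y' * subV by auto
      then have cvW: "c \<odot>\<^bsub>M\<^esub> (b \<oplus>\<^bsub>M\<^esub> y') \<in> W" using \<open>V \<subseteq> W\<close> by auto
      have "w \<ominus>\<^bsub>M\<^esub> c \<odot>\<^bsub>M\<^esub> (b \<oplus>\<^bsub>M\<^esub> y') = y \<ominus>\<^bsub>M\<^esub> c \<odot>\<^bsub>M\<^esub> y'"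
      proof -
        have "w = c \<odot>\<^bsub>M\<^esub> b \<oplus>\<^bsub>M\<^esub> y" by fact
        moreover have "c \<odot>\<^bsub>M\<^esub> (b \<oplus>\<^bsub>M\<^esub> y') = c \<odot>\<^bsub>M\<^esub> b \<oplus>\<^bsub>M\<^esub> c \<odot>\<^bsub>M\<^esub> y'"
          using * b y'M by (simp add: smult_r_distr)
        ultimately show ?thesis
          using * b y y'M by (simp add: M.add_minus_add_cancel)
      qed
      moreover have "w \<ominus>\<^bsub>M\<^esub> c \<odot>\<^bsub>M\<^esub> (b \<oplus>\<^bsub>M\<^esub> y') \<in> W"
        using w cvW subW by (auto simp: M.minus_eq)
      moreover have "y \<ominus>\<^bsub>M\<^esub> c \<odot>\<^bsub>M\<^esub> y' \<in> k_span k M bs"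
        using * y' subS by (auto simp: M.minus_eq)
      ultimately have "w \<ominus>\<^bsub>M\<^esub> c \<odot>\<^bsub>M\<^esub> (b \<oplus>\<^bsub>M\<^esub> y') \<in> V" using IH by auto
      then have "(w \<ominus>\<^bsub>M\<^esub> c \<odot>\<^bsub>M\<^esub> (b \<oplus>\<^bsub>M\<^esub> y')) \<oplus>\<^bsub>M\<^esub> c \<odot>\<^bsub>M\<^esub> (b \<oplus>\<^bsub>M\<^esub> y') \<in> V"
        using cv subV by auto
      moreover have "w \<in> carrier M" "c \<odot>\<^bsub>M\<^esub> (b \<oplus>\<^bsub>M\<^esub> y') \<in> carrier M"
        using w cvW subW by auto
      ultimately show ?thesis by (simp add: M.minus_eq M.a_assoc M.l_neg)
    qed
  qed
qed

text \<open>Plain products rather than the ideal power they span: nilpotency asks only that the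
  products vanish, and \<open>generated_by\<close> takes sums later. New factors enter on the left
  because that is where the homotopy produces them.\<close>

primrec ideal_products :: "('a, 'z) ring_scheme \<Rightarrow> 'a set \<Rightarrow> nat \<Rightarrow> 'a set" where
  "ideal_products R I 0 = {\<one>\<^bsub>R\<^esub>}"
| "ideal_products R I (Suc n) = {r \<otimes>\<^bsub>R\<^esub> s | r s. r \<in> I \<and> s \<in> ideal_products R I n}"

lemma (in ring) ideal_products_carrier:
  "I \<subseteq> carrier R \<Longrightarrow> ideal_products R I n \<subseteq> carrier R"
  by (induction n) auto

lemma ideal_products_mono: "I \<subseteq> K \<Longrightarrow> ideal_products R I n \<subseteq> ideal_products R K n"
  by (induction n) (simp, force)

text \<open>A scalar \<open>c\<close> acts as right multiplication by
  \<open>c \<odot> \<one>\<close>.\<close>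

lemma right_ideal_submodule:
  assumes "assoc_algebra k A" "right_ideal A V" shows "submodule V k A"
proof -
  interpret A: ring A using assms(1) by (simp add: assoc_algebra_def)
  interpret assoc_algebra k A by fact
  have V: "V \<subseteq> carrier A" "\<zero>\<^bsub>A\<^esub> \<in> V" "\<And>x y. x \<in> V \<Longrightarrow> y \<in> V \<Longrightarrow> x \<oplus>\<^bsub>A\<^esub> y \<in> V"
    "\<And>x a. x \<in> V \<Longrightarrow> a \<in> carrier A \<Longrightarrow> x \<otimes>\<^bsub>A\<^esub> a \<in> V"
    using assms by (auto simp: A.right_ideal_iff)
  have neg: "\<ominus>\<^bsub>A\<^esub> x \<in> V" if "x \<in> V" for x
    using assms that by (auto simp: right_ideal_def A.additive_subgroup_iff)
  show ?thesis
  proof (rule submoduleI)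
    fix c x assume c: "c \<in> carrier k" and x: "x \<in> V"
    have "x \<otimes>\<^bsub>A\<^esub> (c \<odot>\<^bsub>A\<^esub> \<one>\<^bsub>A\<^esub>) = c \<odot>\<^bsub>A\<^esub> x"
      using c x V by (auto simp: smult_mult_right)
    moreover have "c \<odot>\<^bsub>A\<^esub> \<one>\<^bsub>A\<^esub> \<in> carrier A" using c by simp
    ultimately show "c \<odot>\<^bsub>A\<^esub> x \<in> V" using V(4)[OF x] by metis
  qed (use V neg in auto)
qed

text \<open>A composition series argument with the pivot count as length. A non-zero right ideal
  \<open>V\<close> has a maximal proper right subideal \<open>W\<close>; multiplication by the
  radical takes \<open>V\<close> into \<open>W\<close>, and \<open>W\<close> is killed by products
  of some length \<open>n\<close>, so \<open>V\<close> is killed by products of length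
  \<open>n + 1\<close>. The case \<open>V = A\<close>, applied to \<open>\<one>\<close>, gives the
  claim.\<close>

theorem jacobson_radical_nilpotent:
  assumes "field k" "assoc_algebra k A"
    and bs: "set bs \<subseteq> carrier A" "carrier A \<subseteq> k_span k A bs"
  shows "\<exists>n. ideal_products A (jacobson_radical A) n \<subseteq> {\<zero>\<^bsub>A\<^esub>}"
proof -
  interpret A: ring A using assms(2) by (simp add: assoc_algebra_def)
  interpret assoc_algebra k A by fact
  let ?J = "jacobson_radical A"
  have mod: "module k A" by unfold_locales
  have "\<exists>n. \<forall>v\<in>V. \<forall>s\<in>ideal_products A ?J n. v \<otimes>\<^bsub>A\<^esub> s = \<zero>\<^bsub>A\<^esub>" if "right_ideal A V" for V
    using that
  proof (induction "pivots k A V bs" arbitrary: V rule: less_induct)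
    case less
    have V: "V \<subseteq> carrier A" "\<zero>\<^bsub>A\<^esub> \<in> V" using less.prems by (auto simp: A.right_ideal_iff)
    have smaller: "pivots k A W bs < pivots k A U bs"
      if "right_ideal A W" "right_ideal A U" "W \<subset> U" for W U
    proof -
      have "pivots k A W bs \<noteq> pivots k A U bs"
      proof
        assume "pivots k A W bs = pivots k A U bs"
        then have "U \<inter> k_span k A bs \<subseteq> W"
          using pivots_eq_imp_subset[OF assms(1) mod] right_ideal_submodule[OF assms(2)] that bs by auto
        then show False using that bs by (auto simp: A.right_ideal_iff)
      qed
      then show ?thesis using pivots_mono[of W U k A bs] that by auto
    qed
    show ?case
    proof (cases "V = {\<zero>\<^bsub>A\<^esub>}")
      case True
      then show ?thesis by (intro exI[of _ 0]) auto
    next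
      case False
      \<comment> \<open>Since the count is strictly monotone on right ideals, a member of
        \<open>S\<close> with the largest count is maximal in \<open>S\<close>; the count of
        \<open>V\<close> bounds the search.\<close>
      define S where "S = {W. right_ideal A W \<and> W \<subset> V}"
      have "{\<zero>\<^bsub>A\<^esub>} \<in> S" using False V by (auto simp: S_def A.right_ideal_iff)
      moreover have bd: "\<forall>W. W \<in> S \<longrightarrow> pivots k A W bs < pivots k A V bs"
        using smaller less.prems by (auto simp: S_def)
      ultimately obtain W where W: "W \<in> S" and max: "\<And>U. U \<in> S \<Longrightarrow> pivots k A U bs \<le> pivots k A W bs"
        using ex_has_greatest_nat[of "\<lambda>W. W \<in> S" _ "\<lambda>W. pivots k A W bs" "pivots k A V bs"]
        by (metis less_imp_le)
      have WV: "right_ideal A W" "W \<subset> V" using W by (auto simp: S_def)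
      then obtain n where n: "\<And>v s. v \<in> W \<Longrightarrow> s \<in> ideal_products A ?J n \<Longrightarrow> v \<otimes>\<^bsub>A\<^esub> s = \<zero>\<^bsub>A\<^esub>"
        using less.hyps bd W by blast
      have simple: "U = W \<or> U = V" if "right_ideal A U" "W \<subseteq> U" "U \<subseteq> V" for U
      proof (rule ccontr)
        assume "\<not> (U = W \<or> U = V)"
        then have "U \<in> S" "W \<subset> U" using that by (auto simp: S_def)
        then show False using max[of U] smaller[of W U] WV that by auto
      qed
      have "v \<otimes>\<^bsub>A\<^esub> s = \<zero>\<^bsub>A\<^esub>" if v: "v \<in> V" and s: "s \<in> ideal_products A ?J (Suc n)" for v s
      proof -
        obtain r t where rt: "s = r \<otimes>\<^bsub>A\<^esub> t" "r \<in> ?J" "t \<in> ideal_products A ?J n" using s by auto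
        have "v \<otimes>\<^bsub>A\<^esub> r \<in> W"
          using A.simple_quotient_jacobson[OF less.prems WV(1) _ simple v rt(2)] WV by auto
        then have "v \<otimes>\<^bsub>A\<^esub> r \<otimes>\<^bsub>A\<^esub> t = \<zero>\<^bsub>A\<^esub>" using n rt by auto
        moreover have "t \<in> carrier A" "r \<in> carrier A" "v \<in> carrier A"
          using rt v V A.jacobson_radical_carrier
            A.ideal_products_carrier[OF A.jacobson_radical_carrier, of n] by auto
        ultimately show ?thesis using rt by (simp add: A.m_assoc)
      qed
      then show ?thesis by blast
    qed
  qed
  then obtain n where n: "\<And>v s. \<lbrakk>v \<in> carrier A; s \<in> ideal_products A ?J n\<rbrakk> \<Longrightarrow> v \<otimes>\<^bsub>A\<^esub> s = \<zero>\<^bsub>A\<^esub>"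
    by (metis A.m_closed A.add.m_closed A.right_ideal_iff A.zero_closed subset_refl)
  have "s = \<zero>\<^bsub>A\<^esub>" if "s \<in> ideal_products A ?J n" for s
    using n[OF A.one_closed that] that A.ideal_products_carrier[OF A.jacobson_radical_carrier, of n]
    by auto
  then show ?thesis by blast
qed

section \<open>Graded groups and the sign twist\<close>

context abelian_group
begin

lemma sign_by_closed [simp]: "x \<in> carrier G \<Longrightarrow> sign_by G i x \<in> carrier G"
  by (simp add: sign_by_def)

lemma sign_by_zero [simp]: "sign_by G i \<zero> = \<zero>"
  by (simp add: sign_by_def)

lemma sign_by_add:
  "\<lbrakk>x \<in> carrier G; y \<in> carrier G\<rbrakk> \<Longrightarrow> sign_by G i (x \<oplus> y) = sign_by G i x \<oplus> sign_by G i y"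
  by (simp add: sign_by_def minus_add)

lemma sign_by_pred:
  "x \<in> carrier G \<Longrightarrow> sign_by G (i - 1) x = \<ominus> sign_by G i x"
  by (auto simp: sign_by_def)

lemma sign_by_mem: "additive_subgroup H G \<Longrightarrow> x \<in> H \<Longrightarrow> sign_by G i x \<in> H"
  by (auto simp: sign_by_def additive_subgroup_iff)

text \<open>Brings sums over the varying supports of components or coefficients to a common finite
  index set, where they can be added.\<close>

lemma finsum_support:
  assumes "finite F" "{i. c i \<noteq> z} \<subseteq> F" "\<And>i. i \<in> F \<Longrightarrow> f i z = \<zero>" "\<And>i. i \<in> F \<Longrightarrow> f i (c i) \<in> carrier G"
  shows "(\<Oplus>i\<in>{i. c i \<noteq> z}. f i (c i)) = (\<Oplus>i\<in>F. f i (c i))"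
  using assms by (intro add.finprod_mono_neutral_cong_left) auto

end

locale graded_group = abelian_group G for G (structure) and g +
  assumes graded: "grading G g"
begin

definition component :: "'a \<Rightarrow> int \<Rightarrow> 'a" where
  "component x = (THE c. homogeneous_decomposition G g x c)"

lemma gr_subgroup: "additive_subgroup (g i) G"
  using graded by (simp add: grading_def)

lemma gr_mem:
  "x \<in> g i \<Longrightarrow> x \<in> carrier G" "\<zero> \<in> g i" "x \<in> g i \<Longrightarrow> y \<in> g i \<Longrightarrow> x \<oplus> y \<in> g i"
  "x \<in> g i \<Longrightarrow> \<ominus> x \<in> g i" "x \<in> g i \<Longrightarrow> y \<in> g i \<Longrightarrow> x \<ominus> y \<in> g i"
  using gr_subgroup[of i] by (auto simp: additive_subgroup_iff minus_eq)

lemma component_eqI: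
  assumes "homogeneous_decomposition G g x c" shows "component x = c"
proof -
  have "x \<in> carrier G"
    using assms gr_mem(1) unfolding homogeneous_decomposition_def by (auto intro!: finsum_closed)
  then have "\<exists>!c. homogeneous_decomposition G g x c" using graded by (simp add: grading_def)
  then show ?thesis unfolding component_def by (intro the1_equality assms)
qed

lemma component_decomposition:
  assumes "x \<in> carrier G" shows "homogeneous_decomposition G g x (component x)"
proof -
  have "\<exists>!c. homogeneous_decomposition G g x c" using assms graded by (simp add: grading_def)
  then show ?thesis unfolding component_def by (rule theI')
qed

lemma component_gr: "x \<in> carrier G \<Longrightarrow> component x i \<in> g i"
  and component_finite: "x \<in> carrier G \<Longrightarrow> finite {i. component x i \<noteq> \<zero>}"
  using component_decomposition by (auto simp: homogeneous_decomposition_def)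

lemma component_carrier [simp]: "x \<in> carrier G \<Longrightarrow> component x i \<in> carrier G"
  using component_gr gr_mem(1) by blast

lemma finsum_component:
  assumes "x \<in> carrier G" "finite F" "{i. component x i \<noteq> \<zero>} \<subseteq> F"
  shows "(\<Oplus>i\<in>F. component x i) = x"
  using finsum_support[where f = "\<lambda>i x. x" and c = "component x" and z = \<zero> and F = F]
    component_decomposition[OF assms(1)] assms
  by (simp add: homogeneous_decomposition_def)

lemma component_finsum:
  assumes F: "finite F" and c: "\<And>i. i \<in> F \<Longrightarrow> c i \<in> g i"
  shows "component (\<Oplus>i\<in>F. c i) = (\<lambda>i. if i \<in> F then c i else \<zero>)"
proof (rule component_eqI)
  let ?c = "\<lambda>i. if i \<in> F then c i else \<zero>"
  have fin: "finite {i. ?c i \<noteq> \<zero>}" by (rule finite_subset[OF _ F]) auto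
  have "(\<Oplus>i\<in>F. c i) = (\<Oplus>i\<in>{i. ?c i \<noteq> \<zero>}. ?c i)"
    using F c gr_mem(1) by (intro add.finprod_mono_neutral_cong_right) (auto split: if_splits)
  then show "homogeneous_decomposition G g (\<Oplus>i\<in>F. c i) ?c"
    using c gr_mem(2) fin by (simp add: homogeneous_decomposition_def)
qed

lemma component_homogeneous:
  assumes "x \<in> g i" shows "component x j = (if j = i then x else \<zero>)"
  using component_finsum[of "{i}" "\<lambda>_. x"] assms gr_mem(1)
  by (simp add: finsum_insert)

lemma component_add:
  assumes x: "x \<in> carrier G" and y: "y \<in> carrier G"
  shows "component (x \<oplus> y) i = component x i \<oplus> component y i"
proof -
  define F where "F = insert i ({i. component x i \<noteq> \<zero>} \<union> {i. component y i \<noteq> \<zero>})"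
  have F: "finite F" using x y by (simp add: F_def component_finite)
  have "x \<oplus> y = (\<Oplus>i\<in>F. component x i) \<oplus> (\<Oplus>i\<in>F. component y i)"
  proof -
    have "{i. component x i \<noteq> \<zero>} \<subseteq> F" "{i. component y i \<noteq> \<zero>} \<subseteq> F" by (auto simp: F_def)
    then show ?thesis using finsum_component x y F by metis
  qed
  also have "\<dots> = (\<Oplus>i\<in>F. component x i \<oplus> component y i)"
    using x y by (simp add: finsum_addf)
  finally have sum: "x \<oplus> y = (\<Oplus>i\<in>F. component x i \<oplus> component y i)" .
  have "component (\<Oplus>i\<in>F. component x i \<oplus> component y i) =
      (\<lambda>i. if i \<in> F then component x i \<oplus> component y i else \<zero>)"
    by (intro component_finsum[OF F] gr_mem(3) component_gr x y)
  moreover have "i \<in> F" by (simp add: F_def)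
  ultimately show ?thesis by (simp add: sum)
qed

lemma component_hom: "(\<lambda>x. component x i) \<in> hom (add_monoid G) (add_monoid G)"
  by (auto simp: hom_def component_add)

lemma graded_induct [consumes 1, case_names homogeneous add]:
  assumes "x \<in> carrier G" and "\<And>i x. x \<in> g i \<Longrightarrow> Q x"
    and "\<And>x y. \<lbrakk>x \<in> carrier G; y \<in> carrier G; Q x; Q y\<rbrakk> \<Longrightarrow> Q (x \<oplus> y)"
  shows "Q x"
proof -
  have "(\<Oplus>i\<in>{i. component x i \<noteq> \<zero>}. component x i) \<in> {x \<in> carrier G. Q x}"
    using assms(2)[OF gr_mem(2)] assms(2)[OF component_gr] assms(1,3) by (intro finsum_mem) auto
  then show ?thesis using finsum_component[OF assms(1) component_finite] assms(1) by auto
qed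

lemma sign_twist_sum:
  assumes x: "x \<in> carrier G" and F: "finite F" "{i. component x i \<noteq> \<zero>} \<subseteq> F"
  shows "sign_twist G g x = (\<Oplus>i\<in>F. sign_by G i (component x i))"
proof -
  have "sign_twist G g x = (\<Oplus>i\<in>{i. component x i \<noteq> \<zero>}. sign_by G i (component x i))"
    by (simp add: sign_twist_def component_def Let_def)
  also have "\<dots> = (\<Oplus>i\<in>F. sign_by G i (component x i))"
    using x F by (intro finsum_support) auto
  finally show ?thesis .
qed

lemma sign_twist_closed [simp]: "x \<in> carrier G \<Longrightarrow> sign_twist G g x \<in> carrier G"
  using sign_twist_sum[of x "{i. component x i \<noteq> \<zero>}"] component_finite[of x] by simp

lemma sign_twist_add:
  assumes x: "x \<in> carrier G" and y: "y \<in> carrier G"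
  shows "sign_twist G g (x \<oplus> y) = sign_twist G g x \<oplus> sign_twist G g y"
proof -
  define F where "F = {i. component x i \<noteq> \<zero>} \<union> {i. component y i \<noteq> \<zero>} \<union> {i. component (x \<oplus> y) i \<noteq> \<zero>}"
  have F: "finite F" using x y by (simp add: F_def component_finite)
  have "{i. component x i \<noteq> \<zero>} \<subseteq> F" "{i. component y i \<noteq> \<zero>} \<subseteq> F"
    "{i. component (x \<oplus> y) i \<noteq> \<zero>} \<subseteq> F" by (auto simp: F_def)
  then show ?thesis
    using x y F sign_twist_sum[of x F] sign_twist_sum[of y F] sign_twist_sum[of "x \<oplus> y" F]
    by (simp add: component_add sign_by_add finsum_addf)
qed

lemma sign_twist_homogeneous:
  assumes "x \<in> g i" shows "sign_twist G g x = sign_by G i x"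
proof -
  have "sign_twist G g x = (\<Oplus>i\<in>{i}. sign_by G i (component x i))"
    using assms gr_mem(1) by (intro sign_twist_sum) (auto simp: component_homogeneous)
  then show ?thesis using assms gr_mem(1) by (simp add: finsum_insert component_homogeneous)
qed

lemma sign_twist_sign_twist:
  assumes "x \<in> carrier G" shows "sign_twist G g (sign_twist G g x) = x"
  using assms
proof (induction rule: graded_induct)
  case (homogeneous i x)
  then have "sign_by G i x \<in> g i" using sign_by_mem gr_subgroup by blast
  then show ?case using homogeneous gr_mem(1)[OF homogeneous]
    by (simp add: sign_twist_homogeneous) (simp add: sign_by_def)
qed (simp add: sign_twist_add)

end


section \<open>The ideal \<open>J\<^sub>-\<close>\<close>

lemma dg_algebra_graded_group: "dg_algebra k A \<Longrightarrow> graded_group A (alg_gr A)"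
  by (simp add: graded_group_def graded_group_axioms_def dg_algebra_def dg_algebra_axioms_def
      assoc_algebra_def ring_def)

lemma dg_algebra_ring: "dg_algebra k A \<Longrightarrow> ring A"
  by (simp add: dg_algebra_def assoc_algebra_def)

text \<open>Degrees add under multiplication, so the signs multiply. The twist is thus an involutive
  ring automorphism, which is what lets it act on right ideals.\<close>

lemma sign_twist_mult:
  assumes "dg_algebra k A" "x \<in> carrier A" "y \<in> carrier A"
  shows "sign_twist A (alg_gr A) (x \<otimes>\<^bsub>A\<^esub> y) =
    sign_twist A (alg_gr A) x \<otimes>\<^bsub>A\<^esub> sign_twist A (alg_gr A) y"
proof -
  interpret A: graded_group A "alg_gr A" using assms by (simp add: dg_algebra_graded_group)
  interpret A: ring A using assms by (simp add: dg_algebra_ring)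
  have *: "sign_twist A (alg_gr A) (u \<otimes>\<^bsub>A\<^esub> y) =
      sign_twist A (alg_gr A) u \<otimes>\<^bsub>A\<^esub> sign_twist A (alg_gr A) y" if u: "u \<in> alg_gr A i" for u i
    using assms(3)
  proof (induction y rule: A.graded_induct)
    case (homogeneous j y)
    have "u \<otimes>\<^bsub>A\<^esub> y \<in> alg_gr A (i + j)"
      using u homogeneous dg_algebra.alg_mult_gr[OF assms(1)] by blast
    then show ?case using u homogeneous A.gr_mem(1)[OF u] A.gr_mem(1)[OF homogeneous]
      by (auto simp: A.sign_twist_homogeneous sign_by_def A.r_minus A.l_minus)
  next
    case (add y z)
    then show ?case using A.gr_mem(1)[OF u] by (simp add: A.r_distr A.sign_twist_add)
  qed
  show ?thesis
    using assms(2)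
  proof (induction x rule: A.graded_induct)
    case (homogeneous i x)
    then show ?case by (rule *)
  next
    case (add x z)
    then show ?case using assms(3) by (simp add: A.l_distr A.sign_twist_add)
  qed
qed

text \<open>Elements of \<open>J_minus A\<close> may be inhomogeneous, so the Leibniz rule is needed
  for arbitrary \<open>x\<close>; both sides are additive in \<open>x\<close>.\<close>

lemma alg_d_mult:
  assumes "dg_algebra k A" "x \<in> carrier A" "y \<in> carrier A"
  shows "alg_d A (x \<otimes>\<^bsub>A\<^esub> y) =
    alg_d A x \<otimes>\<^bsub>A\<^esub> y \<oplus>\<^bsub>A\<^esub> sign_twist A (alg_gr A) x \<otimes>\<^bsub>A\<^esub> alg_d A y"
proof -
  interpret A: graded_group A "alg_gr A" using assms by (simp add: dg_algebra_graded_group)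
  interpret A: ring A using assms by (simp add: dg_algebra_ring)
  interpret dg_algebra k A by fact
  show ?thesis
    using assms(2)
  proof (induction x rule: A.graded_induct)
    case (homogeneous i x)
    then show ?case using A.gr_mem(1)[OF homogeneous] assms(3) alg_Leibniz[OF homogeneous assms(3)]
      by (simp add: A.sign_twist_homogeneous sign_by_def A.l_minus alg_d_closed)
  next
    case (add x z)
    then show ?case using assms(3)
      by (simp add: A.l_distr A.sign_twist_add alg_d_add alg_d_closed A.a_ac)
  qed
qed

lemma alg_d_zero: "dg_algebra k A \<Longrightarrow> alg_d A \<zero>\<^bsub>A\<^esub> = \<zero>\<^bsub>A\<^esub>"
  and alg_d_minus: "dg_algebra k A \<Longrightarrow> x \<in> carrier A \<Longrightarrow> alg_d A (\<ominus>\<^bsub>A\<^esub> x) = \<ominus>\<^bsub>A\<^esub> alg_d A x"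
proof -
  assume dg: "dg_algebra k A"
  then have ab: "abelian_group A" and hom: "alg_d A \<in> hom (add_monoid A) (add_monoid A)"
    using dg_algebra_graded_group dg_algebra.alg_d_closed dg_algebra.alg_d_add
    by (auto simp: graded_group_def hom_def)
  show "alg_d A \<zero>\<^bsub>A\<^esub> = \<zero>\<^bsub>A\<^esub>" by (rule additive_zero[OF ab ab hom])
  show "alg_d A (\<ominus>\<^bsub>A\<^esub> x) = \<ominus>\<^bsub>A\<^esub> alg_d A x" if "x \<in> carrier A" by (rule additive_minus[OF ab ab hom that])
qed

lemma alg_d_one: "dg_algebra k A \<Longrightarrow> alg_d A \<one>\<^bsub>A\<^esub> = \<zero>\<^bsub>A\<^esub>"
proof -
  assume dg: "dg_algebra k A"
  interpret A: graded_group A "alg_gr A" using dg by (simp add: dg_algebra_graded_group)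
  interpret A: ring A using dg by (simp add: dg_algebra_ring)
  interpret dg_algebra k A by fact
  have "alg_d A \<one>\<^bsub>A\<^esub> = alg_d A \<one>\<^bsub>A\<^esub> \<oplus>\<^bsub>A\<^esub> alg_d A \<one>\<^bsub>A\<^esub>"
    using alg_Leibniz[OF alg_one_gr A.one_closed] by (simp add: sign_by_def alg_d_closed)
  then show ?thesis by (simp add: alg_d_closed A.add.l_cancel_one')
qed

text \<open>Taking preimages under the twist is an inclusion-preserving involution on right ideals.
  It therefore permutes the maximal ones and leaves their intersection invariant.\<close>

lemma sign_twist_jacobson_radical:
  assumes dg: "dg_algebra k A" and x: "x \<in> jacobson_radical A"
  shows "sign_twist A (alg_gr A) x \<in> jacobson_radical A"
proof -
  interpret A: graded_group A "alg_gr A" using dg by (simp add: dg_algebra_graded_group)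
  interpret A: ring A using dg by (simp add: dg_algebra_ring)
  let ?\<sigma> = "sign_twist A (alg_gr A)"
  have hom: "?\<sigma> \<in> hom (add_monoid A) (add_monoid A)"
    by (simp add: hom_def A.sign_twist_add)
  have "?\<sigma> \<zero>\<^bsub>A\<^esub> = \<zero>\<^bsub>A\<^esub>"
    by (rule additive_zero[OF _ _ hom]) unfold_locales
  define twist where "twist K = {a \<in> carrier A. ?\<sigma> a \<in> K}" for K
  have ri: "right_ideal A (twist K)" if "right_ideal A K" for K
    using that dg \<open>?\<sigma> \<zero>\<^bsub>A\<^esub> = \<zero>\<^bsub>A\<^esub>\<close>
    unfolding A.right_ideal_iff twist_def by (auto simp: A.sign_twist_add sign_twist_mult)
  have tt: "twist (twist K) = K" if "right_ideal A K" for K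
    using that unfolding A.right_ideal_iff twist_def by (auto simp: A.sign_twist_sign_twist)
  have mono: "twist K \<subseteq> twist L" if "K \<subseteq> L" for K L using that by (auto simp: twist_def)
  have "?\<sigma> x \<in> K" if K: "maximal_right_ideal A K" for K
  proof -
    have "maximal_right_ideal A (twist K)"
      unfolding maximal_right_ideal_def
    proof (intro conjI allI impI)
      have K': "right_ideal A K" "K \<noteq> carrier A" using K by (auto simp: maximal_right_ideal_def)
      then show "right_ideal A (twist K)" using ri by blast
      have "twist (carrier A) = carrier A" by (auto simp: twist_def)
      then show "twist K \<noteq> carrier A" using K' tt by metis
      fix L assume L: "right_ideal A L \<and> twist K \<subseteq> L"
      then have "K \<subseteq> twist L" using mono tt K' by metis
      then have "twist L = K \<or> twist L = carrier A"
        using K ri L by (auto simp: maximal_right_ideal_def)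
      then show "L = twist K \<or> L = carrier A"
        using tt L \<open>twist (carrier A) = carrier A\<close> by metis
    qed
    then show ?thesis using x by (auto simp: jacobson_radical_def twist_def)
  qed
  then show ?thesis using x by (simp add: jacobson_radical_def)
qed

text \<open>The delicate case is multiplication from the right: \<open>d (a x)\<close> contains the
  twist of \<open>a\<close> times \<open>d x\<close>, which lies in the radical because the radical
  is invariant under the twist.\<close>

lemma ideal_J_minus:
  assumes dg: "dg_algebra k A"
  shows "ideal (J_minus A) A"
proof -
  interpret A: ring A using dg by (simp add: dg_algebra_ring)
  interpret dg_algebra k A by fact
  let ?J = "jacobson_radical A"
  have J: "?J \<subseteq> carrier A" "\<zero>\<^bsub>A\<^esub> \<in> ?J" "\<And>x y. \<lbrakk>x \<in> ?J; y \<in> ?J\<rbrakk> \<Longrightarrow> x \<oplus>\<^bsub>A\<^esub> y \<in> ?J"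
    "\<And>x a. \<lbrakk>x \<in> ?J; a \<in> carrier A\<rbrakk> \<Longrightarrow> x \<otimes>\<^bsub>A\<^esub> a \<in> ?J" "\<And>x. x \<in> ?J \<Longrightarrow> \<ominus>\<^bsub>A\<^esub> x \<in> ?J"
    "\<And>x a. \<lbrakk>x \<in> ?J; a \<in> carrier A\<rbrakk> \<Longrightarrow> a \<otimes>\<^bsub>A\<^esub> x \<in> ?J"
    using A.right_ideal_jacobson_radical A.jacobson_radical_left
    by (auto simp: A.right_ideal_iff right_ideal_def A.additive_subgroup_iff)
  interpret G: graded_group A "alg_gr A" using dg by (simp add: dg_algebra_graded_group)
  show ?thesis
  proof (rule idealI)
    show "ring A" by (rule dg_algebra_ring[OF dg])
    show "subgroup (J_minus A) (add_monoid A)"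
      using J by (intro additive_subgroup.a_subgroup)
        (auto simp: A.additive_subgroup_iff J_minus_def alg_d_zero[OF dg] alg_d_minus[OF dg] alg_d_add subset_iff)
  next
    fix a x assume "a \<in> J_minus A" and x: "x \<in> carrier A"
    then have a: "a \<in> ?J" "alg_d A a \<in> ?J" "a \<in> carrier A" using J by (auto simp: J_minus_def)
    show "x \<otimes>\<^bsub>A\<^esub> a \<in> J_minus A"
      using a x J by (simp add: J_minus_def alg_d_mult[OF dg] alg_d_closed)
    show "a \<otimes>\<^bsub>A\<^esub> x \<in> J_minus A"
      using a x J sign_twist_jacobson_radical[OF dg a(1)]
      by (simp add: J_minus_def alg_d_mult[OF dg] alg_d_closed)
  qed
qed

lemma J_minus_alg_d:
  assumes dg: "dg_algebra k A" and "x \<in> J_minus A"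
  shows "alg_d A x \<in> J_minus A"
proof -
  interpret A: ring A using dg by (simp add: dg_algebra_ring)
  interpret dg_algebra k A by fact
  have "\<zero>\<^bsub>A\<^esub> \<in> jacobson_radical A"
    using A.right_ideal_jacobson_radical by (simp add: A.right_ideal_iff)
  then show ?thesis using assms(2) A.jacobson_radical_carrier by (auto simp: J_minus_def alg_d_d)
qed

text \<open>Spanning sets of the components in degrees \<open>-n\<close> to \<open>n\<close> are put
  together, all other components being zero. This turns finiteness in each degree into the finite
  spanning list that the pivot count requires.\<close>

lemma fd_dg_algebra_k_span:
  assumes "fd_dg_algebra k A"
  obtains bs where "set bs \<subseteq> carrier A" "carrier A \<subseteq> k_span k A bs"
proof -
  interpret A: ring A using assms dg_algebra_ring unfolding fd_dg_algebra_def by blast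
  interpret fd_dg_algebra k A by fact
  have dg: "dg_algebra k A" by unfold_locales
  have mod: "module k A" by unfold_locales
  interpret G: graded_group A "alg_gr A" using dg by (simp add: dg_algebra_graded_group)
  define spans where "spans i B \<longleftrightarrow> finite B \<and> B \<subseteq> alg_gr A i \<and>
      (\<forall>x\<in>alg_gr A i. \<exists>c\<in>B \<rightarrow> carrier k. x = (\<Oplus>\<^bsub>A\<^esub>b\<in>B. c b \<odot>\<^bsub>A\<^esub> b))" for i B
  have "\<forall>i. \<exists>B. spans i B" using fd_components unfolding finite_dim_subspace_def spans_def by blast
  then obtain B where "\<forall>i. spans i (B i)" by (rule choice[THEN exE])
  then have B: "\<And>i. finite (B i)" "\<And>i. B i \<subseteq> alg_gr A i"
    "\<And>i x. x \<in> alg_gr A i \<Longrightarrow> \<exists>c\<in>B i \<rightarrow> carrier k. x = (\<Oplus>\<^bsub>A\<^esub>b\<in>B i. c b \<odot>\<^bsub>A\<^esub> b)"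
    by (simp_all add: spans_def)
  obtain n where n: "\<And>i. \<bar>i\<bar> > n \<Longrightarrow> alg_gr A i = {\<zero>\<^bsub>A\<^esub>}" using bounded_components by blast
  obtain bs where bs: "set bs = (\<Union>i\<in>{-n..n}. B i)"
    using finite_list[of "\<Union>i\<in>{-n..n}. B i"] B(1) by auto
  have bsA: "set bs \<subseteq> carrier A" using bs B(2) G.gr_mem(1) by blast
  note S = submoduleE[OF submodule_k_span[OF bsA]]
  have zero: "\<zero>\<^bsub>A\<^esub> \<in> k_span k A bs"
    using submodule_k_span[OF bsA] submodule.axioms(1) subgroup.one_closed by fastforce
  have gr: "x \<in> k_span k A bs" if x: "x \<in> alg_gr A i" for x i
  proof (cases "\<bar>i\<bar> > n")
    case True
    then show ?thesis using n x zero by auto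
  next
    case False
    obtain c where c: "c \<in> B i \<rightarrow> carrier k" "x = (\<Oplus>\<^bsub>A\<^esub>b\<in>B i. c b \<odot>\<^bsub>A\<^esub> b)" using B(3)[OF x] by blast
    have i: "i \<in> {-n..n}" using False by auto
    have "B i \<subseteq> k_span k A bs" using set_subset_k_span[OF bsA] bs i by blast
    then have mem: "c b \<odot>\<^bsub>A\<^esub> b \<in> k_span k A bs" if "b \<in> B i" for b
      using S(4)[of "c b" b] c(1) that by blast
    show ?thesis unfolding c(2)
    proof (rule A.finsum_mem)
      show "k_span k A bs \<subseteq> carrier A" "\<zero>\<^bsub>A\<^esub> \<in> k_span k A bs" by (fact S(1) zero)+
      show "x \<oplus>\<^bsub>A\<^esub> y \<in> k_span k A bs" if "x \<in> k_span k A bs" "y \<in> k_span k A bs" for x y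
        using S(5) that .
    qed (fact mem)
  qed
  have "x \<in> k_span k A bs" if "x \<in> carrier A" for x
    using that by (induction rule: G.graded_induct) (erule gr, rule S(5))
  then show ?thesis using that bsA by blast
qed

lemma J_minus_nilpotent:
  assumes fd: "fd_dg_algebra k A"
  shows "\<exists>n. ideal_products A (J_minus A) n \<subseteq> {\<zero>\<^bsub>A\<^esub>}"
proof -
  obtain bs where "set bs \<subseteq> carrier A" "carrier A \<subseteq> k_span k A bs"
    using fd_dg_algebra_k_span[OF fd] .
  moreover have "field k" "assoc_algebra k A"
    using fd by (auto simp: fd_dg_algebra_def dg_algebra_def)
  ultimately obtain n where "ideal_products A (jacobson_radical A) n \<subseteq> {\<zero>\<^bsub>A\<^esub>}"
    using jacobson_radical_nilpotent by blast
  moreover have "J_minus A \<subseteq> jacobson_radical A" by (auto simp: J_minus_def)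
  ultimately have "ideal_products A (J_minus A) n \<subseteq> {\<zero>\<^bsub>A\<^esub>}"
    using ideal_products_mono by (metis subset_trans)
  then show ?thesis ..
qed

section \<open>Right DG modules\<close>

lemma (in abelian_group) generate_induct [consumes 2, case_names zero incl add]:
  assumes "x \<in> generate (add_monoid G) S" "S \<subseteq> carrier G"
    and "Q \<zero>" "\<And>x. x \<in> S \<Longrightarrow> Q x \<and> Q (\<ominus> x)"
    and "\<And>x y. \<lbrakk>x \<in> carrier G; y \<in> carrier G; Q x; Q y\<rbrakk> \<Longrightarrow> Q (x \<oplus> y)"
  shows "Q x"
proof -
  have "x \<in> carrier G \<and> Q x" using assms(1)
  proof (induction rule: generate.induct)
    case (inv h)
    then show ?case using assms(2,4) by (auto simp: a_inv_def[symmetric])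
  qed (use assms in auto)
  then show ?thesis ..
qed

lemma (in abelian_group) additive_subgroup_generate:
  assumes "S \<subseteq> carrier G" shows "additive_subgroup (generate (add_monoid G) S) G"
  using add.generate_is_subgroup[of S] assms by (simp add: additive_subgroup_def)

locale right_dg_module = A: ring A + alg: dg_algebra k A + P: dg_module A P
  for k :: "'k ring" and A :: "('k, 'a) dga" and P :: "('a, 'p) dgmod"
begin

sublocale AG: graded_group A "alg_gr A"
  by (rule dg_algebra_graded_group) unfold_locales

sublocale PG: graded_group P "gr P"
  by unfold_locales (rule P.gr_grading)

lemma dg_algebra: "dg_algebra k A"
  by unfold_locales

lemma P_abelian: "abelian_group P" and A_abelian: "abelian_group A"
  by unfold_locales

lemma ract_left_hom: "a \<in> carrier A \<Longrightarrow> (\<lambda>x. ract P x a) \<in> hom (add_monoid P) (add_monoid P)"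
  by (auto simp: hom_def P.ract_closed P.ract_add_left)

lemma ract_right_hom: "x \<in> carrier P \<Longrightarrow> ract P x \<in> hom (add_monoid A) (add_monoid P)"
  by (auto simp: hom_def P.ract_closed P.ract_add_right)

lemma diff_hom: "diff P \<in> hom (add_monoid P) (add_monoid P)"
  by (auto simp: hom_def P.diff_closed P.diff_add)

declare P.ract_closed [simp] P.diff_closed [simp] P.diff_diff [simp] alg.alg_d_closed [simp]

lemma ract_zero [simp]:
  "a \<in> carrier A \<Longrightarrow> ract P \<zero>\<^bsub>P\<^esub> a = \<zero>\<^bsub>P\<^esub>" "x \<in> carrier P \<Longrightarrow> ract P x \<zero>\<^bsub>A\<^esub> = \<zero>\<^bsub>P\<^esub>"
  using additive_zero[OF P_abelian P_abelian ract_left_hom]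
    additive_zero[OF A_abelian P_abelian ract_right_hom] by auto

lemma ract_minus:
  assumes "x \<in> carrier P" "a \<in> carrier A"
  shows "ract P (\<ominus>\<^bsub>P\<^esub> x) a = \<ominus>\<^bsub>P\<^esub> ract P x a" "ract P x (\<ominus>\<^bsub>A\<^esub> a) = \<ominus>\<^bsub>P\<^esub> ract P x a"
  using additive_minus[OF P_abelian P_abelian ract_left_hom]
    additive_minus[OF A_abelian P_abelian ract_right_hom] assms by auto

lemma diff_zero [simp]: "diff P \<zero>\<^bsub>P\<^esub> = \<zero>\<^bsub>P\<^esub>"
  by (rule additive_zero[OF P_abelian P_abelian diff_hom])

lemma diff_minus: "x \<in> carrier P \<Longrightarrow> diff P (\<ominus>\<^bsub>P\<^esub> x) = \<ominus>\<^bsub>P\<^esub> diff P x"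
  by (rule additive_minus[OF P_abelian P_abelian diff_hom])

lemma component_ract:
  assumes x: "x \<in> gr P j" and a: "a \<in> carrier A"
  shows "PG.component (ract P x a) n = ract P x (AG.component a (n - j))"
  using a
proof (induction a rule: AG.graded_induct)
  case (homogeneous i a)
  then have "ract P x a \<in> gr P (j + i)" using x P.ract_gr by blast
  then show ?case
    using homogeneous PG.gr_mem(1)[OF x] by (auto simp: PG.component_homogeneous AG.component_homogeneous)
next
  case (add a b)
  then show ?case
    using PG.gr_mem(1)[OF x] by (simp add: P.ract_add_right PG.component_add AG.component_add)
qed

text \<open>For \<open>S = I\<close> this is \<open>PI\<close>, and for
  \<open>S = ideal_products A I m\<close> it is the product of \<open>P\<close> with the
  \<open>m\<close>-th power of \<open>I\<close>; sums of products in \<open>S\<close> are accounted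
  for by the additive span.\<close>

definition generated_by :: "'a set \<Rightarrow> 'p set" where
  "generated_by S = generate (add_monoid P) {ract P x s | x s. x \<in> carrier P \<and> s \<in> S}"

lemma generated_by_additive: "S \<subseteq> carrier A \<Longrightarrow> additive_subgroup (generated_by S) P"
  unfolding generated_by_def by (rule P.additive_subgroup_generate) auto

lemma generated_by_mem:
  assumes "S \<subseteq> carrier A"
  shows "x \<in> generated_by S \<Longrightarrow> x \<in> carrier P" "\<zero>\<^bsub>P\<^esub> \<in> generated_by S"
    "\<lbrakk>x \<in> generated_by S; y \<in> generated_by S\<rbrakk> \<Longrightarrow> x \<oplus>\<^bsub>P\<^esub> y \<in> generated_by S"
    "x \<in> generated_by S \<Longrightarrow> \<ominus>\<^bsub>P\<^esub> x \<in> generated_by S"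
    "\<lbrakk>x \<in> generated_by S; y \<in> generated_by S\<rbrakk> \<Longrightarrow> x \<ominus>\<^bsub>P\<^esub> y \<in> generated_by S"
    "\<lbrakk>u \<in> carrier P; s \<in> S\<rbrakk> \<Longrightarrow> ract P u s \<in> generated_by S"
  using generated_by_additive[OF assms]
  by (auto simp: P.additive_subgroup_iff P.minus_eq)
    (auto simp: generated_by_def intro: generate.incl)

text \<open>There is no case for negatives, since a sign can be absorbed into the factor from
  \<open>P\<close>.\<close>

lemma generated_by_induct [consumes 2, case_names zero ract add]:
  assumes "x \<in> generated_by S" "S \<subseteq> carrier A"
    and "Q \<zero>\<^bsub>P\<^esub>" "\<And>x s. \<lbrakk>x \<in> carrier P; s \<in> S\<rbrakk> \<Longrightarrow> Q (ract P x s)"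
    and "\<And>x y. \<lbrakk>x \<in> carrier P; y \<in> carrier P; Q x; Q y\<rbrakk> \<Longrightarrow> Q (x \<oplus>\<^bsub>P\<^esub> y)"
  shows "Q x"
proof -
  let ?G = "{ract P x s | x s. x \<in> carrier P \<and> s \<in> S}"
  have "x \<in> generate (add_monoid P) ?G" "?G \<subseteq> carrier P"
    using assms(1,2) by (auto simp: generated_by_def)
  then show ?thesis
  proof (induction rule: P.generate_induct)
    case (incl x)
    then obtain y s where *: "x = ract P y s" "y \<in> carrier P" "s \<in> S" by auto
    then have "\<ominus>\<^bsub>P\<^esub> x = ract P (\<ominus>\<^bsub>P\<^esub> y) s" using assms(2) by (auto simp: ract_minus)
    then show ?case using * assms(4) by auto
  qed (use assms in auto)
qed

text \<open>The target \<open>U\<close> is kept separate for two uses: with \<open>U = S\<close> a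
  right ideal, the span is a submodule; with \<open>a\<close> a product of \<open>m\<close> elements
  of \<open>S\<close>, the products become one factor longer.\<close>

lemma generated_by_ract:
  assumes "x \<in> generated_by S" "S \<subseteq> carrier A" "a \<in> carrier A" "U \<subseteq> carrier A"
    and "\<And>s. s \<in> S \<Longrightarrow> s \<otimes>\<^bsub>A\<^esub> a \<in> U"
  shows "ract P x a \<in> generated_by U"
  using assms(1,2)
proof (induction rule: generated_by_induct)
  case zero
  then show ?case using assms generated_by_mem(2) by simp
next
  case (ract x s)
  then have "ract P (ract P x s) a = ract P x (s \<otimes>\<^bsub>A\<^esub> a)"
    using assms P.ract_mult[of x s a] by auto
  then show ?case using ract assms generated_by_mem(6)[of U] by simp
next
  case (add x y)
  then show ?case using assms generated_by_mem(3)[of U] by (simp add: P.ract_add_left)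
qed

end


section \<open>Semi-free modules\<close>

locale semifree_module = right_dg_module +
  fixes E :: "'c set" and rank :: "'c \<Rightarrow> nat"
  assumes E_homogeneous: "E \<subseteq> (\<Union>i. gr P i)"
    and basis: "\<And>x. x \<in> carrier P \<Longrightarrow> \<exists>!c. lin_comb A P E c x"
    and diff_basis: "\<And>e. e \<in> E \<Longrightarrow> \<exists>c. lin_comb A P {e' \<in> E. rank e' < rank e} c (diff P e)"
begin

text \<open>A choice, because only non-zero elements have a unique degree, and over the zero algebra
  a basis may contain zero.\<close>

definition deg :: "'c \<Rightarrow> int" where "deg e = (SOME i. e \<in> gr P i)"

lemma deg: "e \<in> E \<Longrightarrow> e \<in> gr P (deg e)"
  unfolding deg_def by (rule someI_ex) (use E_homogeneous in auto)

lemma E_carrier [simp]: "e \<in> E \<Longrightarrow> e \<in> carrier P"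
  using deg PG.gr_mem(1) by blast

definition coef :: "'c \<Rightarrow> 'c \<Rightarrow> 'b" where "coef x = (THE c. lin_comb A P E c x)"

lemma coef_eqI: "\<lbrakk>x \<in> carrier P; lin_comb A P E c x\<rbrakk> \<Longrightarrow> coef x = c"
  unfolding coef_def by (rule the1_equality[OF basis])

lemma lin_comb_coef: "x \<in> carrier P \<Longrightarrow> lin_comb A P E (coef x) x"
  unfolding coef_def by (rule theI'[OF basis])

lemma coef:
  assumes "x \<in> carrier P"
  shows "coef x e \<in> carrier A" "{e. coef x e \<noteq> \<zero>\<^bsub>A\<^esub>} \<subseteq> E" "finite {e. coef x e \<noteq> \<zero>\<^bsub>A\<^esub>}"
  using lin_comb_coef[OF assms] unfolding lin_comb_def by (cases "e \<in> E"; auto)+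

lemma coef_sum:
  assumes F: "finite F" "F \<subseteq> E" and c: "\<And>e. e \<in> F \<Longrightarrow> c e \<in> carrier A"
  shows "coef (\<Oplus>\<^bsub>P\<^esub>e\<in>F. ract P e (c e)) = (\<lambda>e. if e \<in> F then c e else \<zero>\<^bsub>A\<^esub>)"
proof (rule coef_eqI)
  let ?c = "\<lambda>e. if e \<in> F then c e else \<zero>\<^bsub>A\<^esub>"
  have E: "e \<in> carrier P" if "e \<in> F" for e using F that by auto
  show "(\<Oplus>\<^bsub>P\<^esub>e\<in>F. ract P e (c e)) \<in> carrier P" using E c by (intro P.finsum_closed) auto
  have fin: "finite {e. ?c e \<noteq> \<zero>\<^bsub>A\<^esub>}" by (rule finite_subset[OF _ F(1)]) auto
  have "(\<Oplus>\<^bsub>P\<^esub>e\<in>F. ract P e (c e)) = (\<Oplus>\<^bsub>P\<^esub>e\<in>{e. ?c e \<noteq> \<zero>\<^bsub>A\<^esub>}. ract P e (?c e))"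
    using F(1) E c by (intro P.add.finprod_mono_neutral_cong_right) (auto split: if_splits)
  then show "lin_comb A P E ?c (\<Oplus>\<^bsub>P\<^esub>e\<in>F. ract P e (c e))"
    using F c fin by (auto simp: lin_comb_def)
qed

text \<open>The \<open>A\<close>-linear map with values \<open>z\<close> on the basis. It is used
  for maps of degree \<open>-1\<close>, which commute with the right action without a sign.\<close>

definition lin_extend :: "('c \<Rightarrow> 'c) \<Rightarrow> 'c \<Rightarrow> 'c" where
  "lin_extend z x = (\<Oplus>\<^bsub>P\<^esub>e\<in>{e. coef x e \<noteq> \<zero>\<^bsub>A\<^esub>}. ract P (z e) (coef x e))"

lemma lin_extend_sum:
  assumes z: "\<And>e. e \<in> E \<Longrightarrow> z e \<in> carrier P" and x: "x \<in> carrier P"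
    and F: "finite F" "F \<subseteq> E" "{e. coef x e \<noteq> \<zero>\<^bsub>A\<^esub>} \<subseteq> F"
  shows "lin_extend z x = (\<Oplus>\<^bsub>P\<^esub>e\<in>F. ract P (z e) (coef x e))"
  unfolding lin_extend_def
  using z F coef(1)[OF x] by (intro P.finsum_support) auto

lemma basis_sum:
  assumes x: "x \<in> carrier P" and F: "finite F" "F \<subseteq> E" "{e. coef x e \<noteq> \<zero>\<^bsub>A\<^esub>} \<subseteq> F"
  shows "(\<Oplus>\<^bsub>P\<^esub>e\<in>F. ract P e (coef x e)) = x"
proof -
  have "x = (\<Oplus>\<^bsub>P\<^esub>e\<in>{e. coef x e \<noteq> \<zero>\<^bsub>A\<^esub>}. ract P e (coef x e))"
    using lin_comb_coef[OF x] by (simp add: lin_comb_def)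
  also have "\<dots> = (\<Oplus>\<^bsub>P\<^esub>e\<in>F. ract P e (coef x e))"
    using F coef(1)[OF x] by (intro P.finsum_support) auto
  finally show ?thesis ..
qed

lemma coef_ract_basis:
  assumes "e \<in> E" "a \<in> carrier A"
  shows "coef (ract P e a) = (\<lambda>e'. if e' = e then a else \<zero>\<^bsub>A\<^esub>)"
  using coef_sum[of "{e}" "\<lambda>_. a"] assms by (simp add: P.finsum_insert)

lemma lin_extend_ract_basis:
  assumes "\<And>e. e \<in> E \<Longrightarrow> z e \<in> carrier P" and "e \<in> E" "a \<in> carrier A"
  shows "lin_extend z (ract P e a) = ract P (z e) a"
proof -
  have "lin_extend z (ract P e a) = (\<Oplus>\<^bsub>P\<^esub>e'\<in>{e}. ract P (z e') (coef (ract P e a) e'))"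
    using assms by (intro lin_extend_sum) (auto simp: coef_ract_basis)
  then show ?thesis using assms by (simp add: coef_ract_basis P.finsum_insert)
qed

lemma lin_extend_basis:
  assumes "\<And>e. e \<in> E \<Longrightarrow> z e \<in> carrier P" and "e \<in> E"
  shows "lin_extend z e = z e"
  using lin_extend_ract_basis[OF assms A.one_closed] assms by (simp add: P.ract_one)

lemma lin_extend_closed:
  assumes "\<And>e. e \<in> E \<Longrightarrow> z e \<in> carrier P" "x \<in> carrier P"
  shows "lin_extend z x \<in> carrier P"
  unfolding lin_extend_def using assms coef[OF assms(2)] by (intro P.finsum_closed) auto

lemma coef_add:
  assumes x: "x \<in> carrier P" and y: "y \<in> carrier P"
  shows "coef (x \<oplus>\<^bsub>P\<^esub> y) e = coef x e \<oplus>\<^bsub>A\<^esub> coef y e"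
proof -
  define F where "F = {e. coef x e \<noteq> \<zero>\<^bsub>A\<^esub>} \<union> {e. coef y e \<noteq> \<zero>\<^bsub>A\<^esub>}"
  have F: "finite F" "F \<subseteq> E" "{e. coef x e \<noteq> \<zero>\<^bsub>A\<^esub>} \<subseteq> F" "{e. coef y e \<noteq> \<zero>\<^bsub>A\<^esub>} \<subseteq> F"
    using coef(2,3)[OF x] coef(2,3)[OF y] by (auto simp: F_def)
  have E: "e \<in> carrier P" if "e \<in> F" for e using F that by auto
  have "x \<oplus>\<^bsub>P\<^esub> y = (\<Oplus>\<^bsub>P\<^esub>e\<in>F. ract P e (coef x e)) \<oplus>\<^bsub>P\<^esub> (\<Oplus>\<^bsub>P\<^esub>e\<in>F. ract P e (coef y e))"
    using basis_sum[OF x F(1,2,3)] basis_sum[OF y F(1,2,4)] by simp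
  also have "\<dots> = (\<Oplus>\<^bsub>P\<^esub>e\<in>F. ract P e (coef x e) \<oplus>\<^bsub>P\<^esub> ract P e (coef y e))"
    using E coef(1)[OF x] coef(1)[OF y] by (intro P.finsum_addf[symmetric]) auto
  also have "\<dots> = (\<Oplus>\<^bsub>P\<^esub>e\<in>F. ract P e (coef x e \<oplus>\<^bsub>A\<^esub> coef y e))"
    using E coef(1)[OF x] coef(1)[OF y] by (intro P.finsum_cong') (auto simp: P.ract_add_right)
  finally have "coef (x \<oplus>\<^bsub>P\<^esub> y) e = (if e \<in> F then coef x e \<oplus>\<^bsub>A\<^esub> coef y e else \<zero>\<^bsub>A\<^esub>)"
    using coef_sum[OF F(1,2), of "\<lambda>e. coef x e \<oplus>\<^bsub>A\<^esub> coef y e"] coef(1)[OF x] coef(1)[OF y] by simp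
  then show ?thesis by (auto simp: F_def)
qed

lemma lin_extend_add:
  assumes z: "\<And>e. e \<in> E \<Longrightarrow> z e \<in> carrier P" and x: "x \<in> carrier P" and y: "y \<in> carrier P"
  shows "lin_extend z (x \<oplus>\<^bsub>P\<^esub> y) = lin_extend z x \<oplus>\<^bsub>P\<^esub> lin_extend z y"
proof -
  define F where "F = {e. coef x e \<noteq> \<zero>\<^bsub>A\<^esub>} \<union> {e. coef y e \<noteq> \<zero>\<^bsub>A\<^esub>}"
  have F: "finite F" "F \<subseteq> E" "{e. coef x e \<noteq> \<zero>\<^bsub>A\<^esub>} \<subseteq> F" "{e. coef y e \<noteq> \<zero>\<^bsub>A\<^esub>} \<subseteq> F"
    using coef(2,3)[OF x] coef(2,3)[OF y] by (auto simp: F_def)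
  have "{e. coef (x \<oplus>\<^bsub>P\<^esub> y) e \<noteq> \<zero>\<^bsub>A\<^esub>} \<subseteq> F" by (auto simp: F_def coef_add[OF x y])
  then have "lin_extend z (x \<oplus>\<^bsub>P\<^esub> y) = (\<Oplus>\<^bsub>P\<^esub>e\<in>F. ract P (z e) (coef (x \<oplus>\<^bsub>P\<^esub> y) e))"
    using x y F by (intro lin_extend_sum z) auto
  also have "\<dots> = (\<Oplus>\<^bsub>P\<^esub>e\<in>F. ract P (z e) (coef x e) \<oplus>\<^bsub>P\<^esub> ract P (z e) (coef y e))"
    using z F coef(1)[OF x] coef(1)[OF y]
    by (intro P.finsum_cong') (auto simp: coef_add[OF x y] P.ract_add_right subset_iff)
  also have "\<dots> = (\<Oplus>\<^bsub>P\<^esub>e\<in>F. ract P (z e) (coef x e)) \<oplus>\<^bsub>P\<^esub> (\<Oplus>\<^bsub>P\<^esub>e\<in>F. ract P (z e) (coef y e))"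
    using z F coef(1)[OF x] coef(1)[OF y] by (intro P.finsum_addf) (auto simp: subset_iff)
  also have "(\<Oplus>\<^bsub>P\<^esub>e\<in>F. ract P (z e) (coef x e)) = lin_extend z x"
    using x F by (intro lin_extend_sum[symmetric] z) auto
  also have "(\<Oplus>\<^bsub>P\<^esub>e\<in>F. ract P (z e) (coef y e)) = lin_extend z y"
    using y F by (intro lin_extend_sum[symmetric] z) auto
  finally show ?thesis .
qed

text \<open>The case \<open>ract\<close> retains that \<open>e\<close> occurs in the given
  \<open>x\<close>. For \<open>x = d e'\<close> this bounds the rank of \<open>e\<close>, on which
  the recursive construction of the homotopy relies.\<close>

lemma basis_induct [consumes 1, case_names zero ract add]:
  assumes x: "x \<in> carrier P" and "Q \<zero>\<^bsub>P\<^esub>"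
    and "\<And>e a. \<lbrakk>e \<in> E; a \<in> carrier A; coef x e \<noteq> \<zero>\<^bsub>A\<^esub>\<rbrakk> \<Longrightarrow> Q (ract P e a)"
    and "\<And>x y. \<lbrakk>x \<in> carrier P; y \<in> carrier P; Q x; Q y\<rbrakk> \<Longrightarrow> Q (x \<oplus>\<^bsub>P\<^esub> y)"
  shows "Q x"
proof -
  have "(\<Oplus>\<^bsub>P\<^esub>e\<in>{e. coef x e \<noteq> \<zero>\<^bsub>A\<^esub>}. ract P e (coef x e)) \<in> {x \<in> carrier P. Q x}"
  proof (rule P.finsum_mem)
    fix e assume "e \<in> {e. coef x e \<noteq> \<zero>\<^bsub>A\<^esub>}"
    then show "ract P e (coef x e) \<in> {x \<in> carrier P. Q x}"
      using coef[OF x] assms(3)[of e "coef x e"] by auto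
  qed (use assms in auto)
  then show ?thesis using basis_sum[OF x coef(3,2)[OF x]] by simp
qed

text \<open>Replacing each coefficient by its component of degree \<open>n - deg e\<close> gives the
  degree \<open>n\<close> part of \<open>x\<close>, which is \<open>x\<close> again; by uniqueness
  the coefficients did not change.\<close>

lemma coef_gr:
  assumes x: "x \<in> gr P n" and e: "e \<in> E"
  shows "coef x e \<in> alg_gr A (n - deg e)"
proof -
  define F where "F = {e. coef x e \<noteq> \<zero>\<^bsub>A\<^esub>}"
  have xP: "x \<in> carrier P" using x PG.gr_mem(1) by blast
  note c = coef[OF xP, folded F_def]
  have E: "e \<in> carrier P" "e \<in> gr P (deg e)" if "e \<in> F" for e using c that deg by auto
  have "x = PG.component (\<Oplus>\<^bsub>P\<^esub>e\<in>F. ract P e (coef x e)) n"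
    using basis_sum[OF xP, of F] c x by (simp add: PG.component_homogeneous F_def)
  also have "\<dots> = (\<Oplus>\<^bsub>P\<^esub>e\<in>F. PG.component (ract P e (coef x e)) n)"
    using E c by (intro additive_finsum[OF P_abelian P_abelian PG.component_hom]) auto
  also have "\<dots> = (\<Oplus>\<^bsub>P\<^esub>e\<in>F. ract P e (AG.component (coef x e) (n - deg e)))"
    using E c by (intro P.finsum_cong') (auto simp: component_ract)
  finally have "coef x e = coef (\<Oplus>\<^bsub>P\<^esub>e\<in>F. ract P e (AG.component (coef x e) (n - deg e))) e"
    by (rule arg_cong)
  also have "\<dots> = (if e \<in> F then AG.component (coef x e) (n - deg e) else \<zero>\<^bsub>A\<^esub>)"
    using coef_sum[OF c(3,2), of "\<lambda>e. AG.component (coef x e) (n - deg e)"] c(1) by simp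
  finally have "coef x e = (if e \<in> F then AG.component (coef x e) (n - deg e) else \<zero>\<^bsub>A\<^esub>)" .
  then show ?thesis using AG.component_gr[OF c(1)] AG.gr_mem(2) by metis
qed

lemma lin_extend_gr:
  assumes z: "\<And>e. e \<in> E \<Longrightarrow> z e \<in> gr P (deg e - 1)" and x: "x \<in> gr P n"
  shows "lin_extend z x \<in> gr P (n - 1)"
  unfolding lin_extend_def
proof (rule P.finsum_mem)
  have xP: "x \<in> carrier P" using x PG.gr_mem(1) by blast
  fix e assume "e \<in> {e. coef x e \<noteq> \<zero>\<^bsub>A\<^esub>}"
  then have e: "e \<in> E" using coef(2)[OF xP] by auto
  show "ract P (z e) (coef x e) \<in> gr P (n - 1)"
    using P.ract_gr[OF z[OF e] coef_gr[OF x e]] by simp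
qed (use PG.gr_mem in auto)

text \<open>A combination of basis elements of smaller rank is also one over all of
  \<open>E\<close>, so by uniqueness it is the expansion given by \<open>coef\<close>.\<close>

lemma coef_diff_basis:
  assumes "e \<in> E" "coef (diff P e) e' \<noteq> \<zero>\<^bsub>A\<^esub>"
  shows "e' \<in> E" "rank e' < rank e"
proof -
  obtain c where c: "lin_comb A P {e' \<in> E. rank e' < rank e} c (diff P e)"
    using diff_basis assms by blast
  then have "lin_comb A P E c (diff P e)"
    unfolding lin_comb_def using A.zero_closed by (metis (mono_tags, lifting) mem_Collect_eq)
  then have "coef (diff P e) = c" using assms(1) by (intro coef_eqI) auto
  then show "e' \<in> E" "rank e' < rank e"
    using c assms(2) unfolding lin_comb_def by blast+
qed

end

section \<open>Contracting homotopies modulo an ideal\<close>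

context semifree_module
begin

text \<open>
  \<open>1 - (d h + h d)\<close> for the \<open>A\<close>-linear map \<open>h\<close> of degree \<open>-1\<close> with values \<open>z\<close> on the basis.
\<close>

definition defect :: "('c \<Rightarrow> 'c) \<Rightarrow> 'c \<Rightarrow> 'c" where
  "defect z x = x \<ominus>\<^bsub>P\<^esub> (diff P (lin_extend z x) \<oplus>\<^bsub>P\<^esub> lin_extend z (diff P x))"

lemma lin_extend_cong:
  assumes "\<And>e. coef x e \<noteq> \<zero>\<^bsub>A\<^esub> \<Longrightarrow> z e = z' e" "\<And>e. e \<in> E \<Longrightarrow> z e \<in> carrier P" "x \<in> carrier P"
  shows "lin_extend z x = lin_extend z' x"
  unfolding lin_extend_def
proof (rule P.finsum_cong')
  fix e assume "e \<in> {e. coef x e \<noteq> \<zero>\<^bsub>A\<^esub>}"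
  then show "ract P (z e) (coef x e) = ract P (z' e) (coef x e)" using assms(1) by simp
next
  show "(\<lambda>e. ract P (z' e) (coef x e)) \<in> {e. coef x e \<noteq> \<zero>\<^bsub>A\<^esub>} \<rightarrow> carrier P"
  proof
    fix e assume e: "e \<in> {e. coef x e \<noteq> \<zero>\<^bsub>A\<^esub>}"
    then have "z' e \<in> carrier P" using assms coef(2)[OF assms(3)] by force
    then show "ract P (z' e) (coef x e) \<in> carrier P" using coef(1)[OF assms(3)] by simp
  qed
qed simp

context
  fixes z
  assumes z: "\<And>e. e \<in> E \<Longrightarrow> z e \<in> gr P (deg e - 1)"
begin

lemma homotopy_carrier: "e \<in> E \<Longrightarrow> z e \<in> carrier P"
  using z PG.gr_mem(1) by blast

lemma homotopy_closed [simp]: "x \<in> carrier P \<Longrightarrow> lin_extend z x \<in> carrier P"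
  using lin_extend_closed homotopy_carrier by blast

lemma homotopy_add: "\<lbrakk>x \<in> carrier P; y \<in> carrier P\<rbrakk> \<Longrightarrow>
    lin_extend z (x \<oplus>\<^bsub>P\<^esub> y) = lin_extend z x \<oplus>\<^bsub>P\<^esub> lin_extend z y"
  using lin_extend_add homotopy_carrier by blast

lemma homotopy_ract_basis: "\<lbrakk>e \<in> E; a \<in> carrier A\<rbrakk> \<Longrightarrow> lin_extend z (ract P e a) = ract P (z e) a"
  using lin_extend_ract_basis homotopy_carrier by blast

lemma homotopy_zero [simp]: "lin_extend z \<zero>\<^bsub>P\<^esub> = \<zero>\<^bsub>P\<^esub>"
proof (rule additive_zero[OF P_abelian P_abelian])
  show "lin_extend z \<in> hom (add_monoid P) (add_monoid P)" by (auto simp: hom_def homotopy_add)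
qed

lemma homotopy_sign: "x \<in> carrier P \<Longrightarrow> lin_extend z (sign_by P i x) = sign_by P i (lin_extend z x)"
proof -
  assume x: "x \<in> carrier P"
  have "lin_extend z (\<ominus>\<^bsub>P\<^esub> x) = \<ominus>\<^bsub>P\<^esub> lin_extend z x"
  proof (rule additive_minus[OF P_abelian P_abelian _ x])
    show "lin_extend z \<in> hom (add_monoid P) (add_monoid P)" by (auto simp: hom_def homotopy_add)
  qed
  then show ?thesis by (simp add: sign_by_def)
qed

lemma homotopy_ract:
  assumes x: "x \<in> carrier P" and a: "a \<in> carrier A"
  shows "lin_extend z (ract P x a) = ract P (lin_extend z x) a"
  using x
proof (induction x rule: basis_induct)
  case zero
  then show ?case using a by simp
next
  case (ract e b)
  then have eq: "ract P (ract P e b) a = ract P e (b \<otimes>\<^bsub>A\<^esub> a)" using a by (simp add: P.ract_mult)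
  show ?case unfolding eq using ract a homotopy_carrier by (simp add: homotopy_ract_basis) (simp add: P.ract_mult)
next
  case (add x y)
  then show ?case using a by (simp add: P.ract_add_left homotopy_add)
qed

lemma defect_closed [simp]: "x \<in> carrier P \<Longrightarrow> defect z x \<in> carrier P"
  by (simp add: defect_def)

lemma defect_add:
  assumes "x \<in> carrier P" "y \<in> carrier P"
  shows "defect z (x \<oplus>\<^bsub>P\<^esub> y) = defect z x \<oplus>\<^bsub>P\<^esub> defect z y"
  using assms by (simp add: defect_def homotopy_add P.diff_add P.minus_eq P.minus_add P.a_ac)

lemma defect_zero [simp]: "defect z \<zero>\<^bsub>P\<^esub> = \<zero>\<^bsub>P\<^esub>"
  by (simp add: defect_def P.minus_eq)

text \<open>\<open>d h\<close> and \<open>h d\<close> each contribute a term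
  \<open>z e (d a)\<close>, with the signs belonging to the degrees of \<open>z e\<close> and of
  \<open>e\<close>. These degrees differ by one, so the two terms cancel.\<close>

lemma defect_ract_basis:
  assumes e: "e \<in> E" and a: "a \<in> carrier A"
  shows "defect z (ract P e a) = ract P (defect z e) a"
proof -
  have ze: "z e \<in> carrier P" "lin_extend z e = z e"
    using e homotopy_carrier lin_extend_basis by auto
  have "diff P (ract P (z e) a) =
      ract P (diff P (z e)) a \<oplus>\<^bsub>P\<^esub> sign_by P (deg e - 1) (ract P (z e) (alg_d A a))"
    using P.Leibniz[OF z[OF e] a] .
  moreover have "lin_extend z (diff P (ract P e a)) =
      ract P (lin_extend z (diff P e)) a \<oplus>\<^bsub>P\<^esub> sign_by P (deg e) (ract P (z e) (alg_d A a))"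
    using P.Leibniz[OF deg[OF e] a] e a ze by (simp add: homotopy_add homotopy_ract homotopy_sign)
  ultimately have "diff P (lin_extend z (ract P e a)) \<oplus>\<^bsub>P\<^esub> lin_extend z (diff P (ract P e a)) =
      (ract P (diff P (z e)) a \<oplus>\<^bsub>P\<^esub> ract P (lin_extend z (diff P e)) a) \<oplus>\<^bsub>P\<^esub>
      (\<ominus>\<^bsub>P\<^esub> sign_by P (deg e) (ract P (z e) (alg_d A a)) \<oplus>\<^bsub>P\<^esub> sign_by P (deg e) (ract P (z e) (alg_d A a)))"
    using e a ze by (simp add: homotopy_ract_basis P.sign_by_pred P.a_ac)
  also have "\<dots> = ract P (diff P (z e) \<oplus>\<^bsub>P\<^esub> lin_extend z (diff P e)) a"
    using e a ze by (simp add: P.l_neg P.ract_add_left)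
  finally show ?thesis
    using e a ze by (simp add: defect_def P.minus_eq P.ract_add_left ract_minus)
qed

lemma defect_ract:
  assumes x: "x \<in> carrier P" and a: "a \<in> carrier A"
  shows "defect z (ract P x a) = ract P (defect z x) a"
  using x
proof (induction x rule: basis_induct)
  case (ract e b)
  then have eq: "ract P (ract P e b) a = ract P e (b \<otimes>\<^bsub>A\<^esub> a)" using a by (simp add: P.ract_mult)
  show ?case unfolding eq using ract a by (simp add: defect_ract_basis) (simp add: P.ract_mult)
qed (use a in \<open>simp_all add: P.ract_add_left defect_add\<close>)

text \<open>Membership is demanded only for the basis elements occurring in \<open>x\<close>, so
  that it can be applied to \<open>d e\<close> while the homotopy is controlled in smaller rank
  only.\<close>

lemma defect_mem:
  assumes S: "right_ideal A S" and x: "x \<in> carrier P"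
    and "\<And>e. \<lbrakk>e \<in> E; coef x e \<noteq> \<zero>\<^bsub>A\<^esub>\<rbrakk> \<Longrightarrow> defect z e \<in> generated_by S"
  shows "defect z x \<in> generated_by S"
proof -
  have SA: "S \<subseteq> carrier A" and Sa: "\<And>s a. \<lbrakk>s \<in> S; a \<in> carrier A\<rbrakk> \<Longrightarrow> s \<otimes>\<^bsub>A\<^esub> a \<in> S"
    using S by (auto simp: A.right_ideal_iff)
  show ?thesis
    using x
  proof (induction x rule: basis_induct)
    case zero
    then show ?case using generated_by_mem(2)[OF SA] by simp
  next
    case (ract e a)
    then show ?case
      using generated_by_ract[OF _ SA _ SA Sa, of "defect z e" a] assms(3) by (simp add: defect_ract_basis)
  next
    case (add x y)
    then show ?case using generated_by_mem(3)[OF SA] by (simp add: defect_add)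
  qed
qed

lemma defect_gr:
  assumes "x \<in> gr P n" "diff P x = \<zero>\<^bsub>P\<^esub>"
  shows "defect z x \<in> gr P n" "diff P (defect z x) = \<zero>\<^bsub>P\<^esub>"
    "defect z x = x \<ominus>\<^bsub>P\<^esub> diff P (lin_extend z x)" "lin_extend z x \<in> gr P (n - 1)"
proof -
  have x: "x \<in> carrier P" using assms PG.gr_mem(1) by blast
  show eq: "defect z x = x \<ominus>\<^bsub>P\<^esub> diff P (lin_extend z x)" using x assms by (simp add: defect_def)
  show h: "lin_extend z x \<in> gr P (n - 1)" using lin_extend_gr[OF z assms(1)] by blast
  then have "diff P (lin_extend z x) \<in> gr P n" using P.diff_gr[OF h] by simp
  then show "defect z x \<in> gr P n" unfolding eq using assms PG.gr_mem(5) by blast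
  show "diff P (defect z x) = \<zero>\<^bsub>P\<^esub>"
    unfolding eq using x assms by (simp add: P.minus_eq P.diff_add diff_minus)
qed

lemma defect_power:
  assumes S: "S \<subseteq> carrier A" and d: "\<And>x. x \<in> carrier P \<Longrightarrow> defect z x \<in> generated_by S"
    and x: "x \<in> generated_by (ideal_products A S m)"
  shows "defect z x \<in> generated_by (ideal_products A S (Suc m))"
proof -
  note c = A.ideal_products_carrier[OF S]
  show ?thesis
    using x c[of m]
  proof (induction rule: generated_by_induct)
    case zero
    then show ?case using generated_by_mem(2)[OF c, of "Suc m"] by (simp del: ideal_products.simps)
  next
    case (ract x s)
    then have "s \<in> carrier A" using c by blast
    \<comment> \<open>By linearity the defect of \<open>x s\<close> is \<open>s\<close> applied to
      an element of \<open>P S\<close>, so the new factor comes to stand to the left of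
      \<open>s\<close>.\<close>
    then have "ract P (defect z x) s \<in> generated_by (ideal_products A S (Suc m))"
      using ract by (intro generated_by_ract[OF d[OF ract(1)] S _ c]) auto
    then show ?case using ract \<open>s \<in> carrier A\<close> by (simp add: defect_ract)
  next
    case (add x y)
    then show ?case using generated_by_mem(3)[OF c, of _ "Suc m"] by (simp add: defect_add del: ideal_products.simps)
  qed
qed

end

text \<open>The assumption \<open>acyclic\<close> is exactness of the complex \<open>P/PS\<close>,
  written without the quotient. It provides the value of the homotopy at each basis element once the
  values in smaller rank are fixed.\<close>

lemma exists_homotopy:
  assumes S: "right_ideal A S"
    and acyclic: "\<And>n y. \<lbrakk>y \<in> gr P n; diff P y \<in> generated_by S\<rbrakk> \<Longrightarrow>
      \<exists>w\<in>gr P (n - 1). y \<ominus>\<^bsub>P\<^esub> diff P w \<in> generated_by S"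
  obtains z where "\<And>e. e \<in> E \<Longrightarrow> z e \<in> gr P (deg e - 1)"
    "\<And>x. x \<in> carrier P \<Longrightarrow> defect z x \<in> generated_by S"
proof -
  \<comment> \<open>An admissible value \<open>r\<close> at \<open>e\<close>, relative to values
    \<open>f\<close> in smaller rank. Truncating \<open>f\<close> makes admissibility depend on
    those values alone, as well-founded choice requires; the zeros are harmless because
    \<open>d e\<close> involves only smaller rank.\<close>
  define good where "good f e r \<longleftrightarrow> (e \<in> E \<longrightarrow> r \<in> gr P (deg e - 1) \<and>
      e \<ominus>\<^bsub>P\<^esub> (diff P r \<oplus>\<^bsub>P\<^esub>
        lin_extend (\<lambda>e'. if e' \<in> E \<and> rank e' < rank e then f e' else \<zero>\<^bsub>P\<^esub>) (diff P e)) \<in> generated_by S)"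
    for f :: "'c \<Rightarrow> 'c" and e r
  have "\<exists>f. \<forall>e. good f e (f e)"
  proof (rule dependent_wf_choice[of "measure rank"])
    fix f g :: "'c \<Rightarrow> 'c" and e r assume "\<And>e'. (e', e) \<in> measure rank \<Longrightarrow> f e' = g e'"
    then have "(\<lambda>e'. if e' \<in> E \<and> rank e' < rank e then f e' else \<zero>\<^bsub>P\<^esub>) =
        (\<lambda>e'. if e' \<in> E \<and> rank e' < rank e then g e' else \<zero>\<^bsub>P\<^esub>)" by auto
    then show "good f e r = good g e r" by (simp add: good_def)
  next
    fix e and f :: "'c \<Rightarrow> 'c" assume IH: "\<And>e'. (e', e) \<in> measure rank \<Longrightarrow> good f e' (f e')"
    \<comment> \<open>Zero lies in every component, so \<open>f'\<close> has the right degrees on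
      the whole basis and the lemmas on defects apply to it although the recursion has only reached
      the rank of \<open>e\<close>.\<close>
    define f' where "f' = (\<lambda>e'. if e' \<in> E \<and> rank e' < rank e then f e' else \<zero>\<^bsub>P\<^esub>)"
    have f': "f' e' \<in> gr P (deg e' - 1)" if "e' \<in> E" for e'
      using IH[of e'] that PG.gr_mem(2) by (auto simp: f'_def good_def)
    have f'P: "f' e' \<in> carrier P" if "e' \<in> E" for e' using f'[OF that] PG.gr_mem(1) by blast
    \<comment> \<open>Truncating at the rank of \<open>e\<close> or at that of \<open>e'\<close>
      makes no difference on \<open>d e'\<close>, whose basis elements have rank below that of
      \<open>e'\<close>.\<close>
    have lower: "defect f' e' \<in> generated_by S" if e': "e' \<in> E" "rank e' < rank e" for e'
    proof -
      have "lin_extend f' (diff P e') =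
          lin_extend (\<lambda>u. if u \<in> E \<and> rank u < rank e' then f u else \<zero>\<^bsub>P\<^esub>) (diff P e')"
        using e' f'P coef_diff_basis[OF e'(1)]
        by (intro lin_extend_cong) (force simp: f'_def)+
      moreover have "lin_extend f' e' = f e'"
        using lin_extend_basis[OF f'P e'(1)] e' by (simp add: f'_def)
      ultimately show ?thesis using IH[of e'] e' by (simp add: defect_def good_def)
    qed
    show "\<exists>r. good f e r"
    proof (cases "e \<in> E")
      case e: True
      \<comment> \<open>The value \<open>w\<close> at \<open>e\<close> has to satisfy
        \<open>d w = y\<close> modulo \<open>P S\<close>. Since \<open>d d e = 0\<close>,
        \<open>d y\<close> is the defect of \<open>d e\<close>, which lies in \<open>P S\<close> by
        the lower ranks; so \<open>y\<close> is a cocycle modulo \<open>P S\<close>.\<close>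
      define y where "y = e \<ominus>\<^bsub>P\<^esub> lin_extend f' (diff P e)"
      have de: "diff P e \<in> carrier P" "lin_extend f' (diff P e) \<in> carrier P"
        using e homotopy_closed[OF f'] by auto
      have h0: "lin_extend f' \<zero>\<^bsub>P\<^esub> = \<zero>\<^bsub>P\<^esub>" by (rule homotopy_zero[OF f'])
      have "lin_extend f' (diff P e) \<in> gr P (deg e)"
        using lin_extend_gr[OF f' P.diff_gr[OF deg[OF e]]] by simp
      then have "y \<in> gr P (deg e)" using PG.gr_mem(5) deg[OF e] by (simp add: y_def)
      moreover have "diff P y = defect f' (diff P e)"
        using e de h0 by (simp add: y_def defect_def P.minus_eq P.diff_add diff_minus)
      moreover have "defect f' (diff P e) \<in> generated_by S"
        by (rule defect_mem[OF f' S de(1)]) (use lower coef_diff_basis[OF e] in auto)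
      ultimately obtain w where w: "w \<in> gr P (deg e - 1)" "y \<ominus>\<^bsub>P\<^esub> diff P w \<in> generated_by S"
        using acyclic by metis
      have "w \<in> carrier P" using w PG.gr_mem(1) by blast
      then have "y \<ominus>\<^bsub>P\<^esub> diff P w = e \<ominus>\<^bsub>P\<^esub> (diff P w \<oplus>\<^bsub>P\<^esub> lin_extend f' (diff P e))"
        using e de by (simp add: y_def P.minus_eq P.minus_add P.a_ac)
      then show ?thesis using w by (auto simp: good_def f'_def)
    qed (simp add: good_def)
  qed simp
  then obtain f where f: "\<And>e. good f e (f e)" by blast
  have fgr: "f e \<in> gr P (deg e - 1)" if "e \<in> E" for e using f[of e] that by (simp add: good_def)
  have fP: "f e \<in> carrier P" if "e \<in> E" for e using fgr[OF that] PG.gr_mem(1) by blast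
  have basis: "defect f e \<in> generated_by S" if e: "e \<in> E" for e
  proof -
    have "lin_extend f (diff P e) =
        lin_extend (\<lambda>u. if u \<in> E \<and> rank u < rank e then f u else \<zero>\<^bsub>P\<^esub>) (diff P e)"
      using e fP coef_diff_basis[OF e] by (intro lin_extend_cong) auto
    then show ?thesis using f[of e] e lin_extend_basis[OF fP e] by (simp add: defect_def good_def)
  qed
  have "defect f x \<in> generated_by S" if "x \<in> carrier P" for x
    by (rule defect_mem[OF fgr S that]) (use basis in auto)
  then show ?thesis using that fgr by blast
qed

text \<open>Each round replaces the cocycle \<open>x' = x - d w\<close> by its defect, adding
  \<open>h x'\<close> to \<open>w\<close>. The invariant records the degree as well, so that the
  correction has degree \<open>n - 1\<close>.\<close>

lemma acyclic_lift:
  assumes S: "right_ideal A S" and nil: "ideal_products A S N \<subseteq> {\<zero>\<^bsub>A\<^esub>}"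
    and acyclic: "\<And>n y. \<lbrakk>y \<in> gr P n; diff P y \<in> generated_by S\<rbrakk> \<Longrightarrow>
      \<exists>w\<in>gr P (n - 1). y \<ominus>\<^bsub>P\<^esub> diff P w \<in> generated_by S"
    and x: "x \<in> gr P n" "diff P x = \<zero>\<^bsub>P\<^esub>"
  shows "x \<in> diff P ` gr P (n - 1)"
proof -
  obtain z where z: "\<And>e. e \<in> E \<Longrightarrow> z e \<in> gr P (deg e - 1)"
    "\<And>x. x \<in> carrier P \<Longrightarrow> defect z x \<in> generated_by S"
    using exists_homotopy[OF S acyclic] by metis
  have SA: "S \<subseteq> carrier A" using S by (simp add: A.right_ideal_iff)
  have xP: "x \<in> carrier P" using x PG.gr_mem(1) by blast
  have "\<exists>w\<in>gr P (n - 1). x \<ominus>\<^bsub>P\<^esub> diff P w \<in> generated_by (ideal_products A S m) \<inter> gr P n" for m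
  proof (induction m)
    \<comment> \<open>The only product of length zero is \<open>\<one>\<close>, so the span is all
      of \<open>P\<close> and \<open>w = \<zero>\<close> will do.\<close>
    case 0
    have "ract P x \<one>\<^bsub>A\<^esub> \<in> generated_by {\<one>\<^bsub>A\<^esub>}" using xP by (intro generated_by_mem(6)) auto
    moreover have "x \<ominus>\<^bsub>P\<^esub> diff P \<zero>\<^bsub>P\<^esub> = x" using xP by (simp add: P.minus_eq)
    ultimately show ?case
      using xP x PG.gr_mem(2) by (intro bexI[of _ "\<zero>\<^bsub>P\<^esub>"]) (simp_all add: P.ract_one)
  next
    case (Suc m)
    then obtain w where w: "w \<in> gr P (n - 1)"
      "x \<ominus>\<^bsub>P\<^esub> diff P w \<in> generated_by (ideal_products A S m)" "x \<ominus>\<^bsub>P\<^esub> diff P w \<in> gr P n" by blast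
    define x' where "x' = x \<ominus>\<^bsub>P\<^esub> diff P w"
    have wP: "w \<in> carrier P" using w PG.gr_mem(1) by blast
    have dx': "diff P x' = \<zero>\<^bsub>P\<^esub>" using wP xP x by (simp add: x'_def P.minus_eq P.diff_add diff_minus)
    note d = defect_gr[OF z(1) w(3)[folded x'_def] dx', simplified]
    have "lin_extend z x' \<in> carrier P" using d(4) PG.gr_mem(1) by blast
    then have "defect z x' = x \<ominus>\<^bsub>P\<^esub> diff P (w \<oplus>\<^bsub>P\<^esub> lin_extend z x')"
      using wP xP d(3) by (simp add: x'_def P.minus_eq P.diff_add P.minus_add P.a_ac)
    moreover have "defect z x' \<in> generated_by (ideal_products A S (Suc m))"
      using defect_power[OF z(1) SA z(2) w(2)[folded x'_def]] .
    moreover have "w \<oplus>\<^bsub>P\<^esub> lin_extend z x' \<in> gr P (n - 1)" using w d PG.gr_mem(3) by blast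
    ultimately show ?case using d(1) by auto
  qed
  then obtain w where w: "w \<in> gr P (n - 1)" "x \<ominus>\<^bsub>P\<^esub> diff P w \<in> generated_by (ideal_products A S N)" by blast
  have "u = \<zero>\<^bsub>P\<^esub>" if "u \<in> generated_by (ideal_products A S N)" for u
    using that A.ideal_products_carrier[OF SA] by (induction rule: generated_by_induct) (use nil in auto)
  then have "x \<ominus>\<^bsub>P\<^esub> diff P w = \<zero>\<^bsub>P\<^esub>" using w by blast
  moreover have "x = (x \<ominus>\<^bsub>P\<^esub> diff P w) \<oplus>\<^bsub>P\<^esub> diff P w"
    using xP PG.gr_mem(1)[OF w(1)] by (simp add: P.minus_eq P.a_assoc P.l_neg)
  ultimately have "x = diff P w" using PG.gr_mem(1)[OF w(1)] by simp
  then show ?thesis using w by blast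
qed

end

section \<open>Reduction modulo a DG ideal\<close>

text \<open>The laws of congruence modulo \<open>H\<close>, with
  \<open>p \<ominus> q \<in> H\<close> in place of an equality in the quotient group.\<close>

lemma (in abelian_group) subgroup_cong:
  assumes "additive_subgroup H G" "p \<in> carrier G" "q \<in> carrier G"
  shows subgroup_cong_sym: "p \<ominus> q \<in> H \<Longrightarrow> q \<ominus> p \<in> H"
    and subgroup_cong_trans: "\<lbrakk>r \<in> carrier G; p \<ominus> q \<in> H; q \<ominus> r \<in> H\<rbrakk> \<Longrightarrow> p \<ominus> r \<in> H"
    and subgroup_cong_minus: "p \<ominus> q \<in> H \<Longrightarrow> (\<ominus> p) \<ominus> (\<ominus> q) \<in> H"
    and subgroup_cong_add: "\<lbrakk>p' \<in> carrier G; q' \<in> carrier G; p \<ominus> q \<in> H; p' \<ominus> q' \<in> H\<rbrakk> \<Longrightarrow>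
      (p \<oplus> p') \<ominus> (q \<oplus> q') \<in> H"
proof -
  have H: "\<And>x y. \<lbrakk>x \<in> H; y \<in> H\<rbrakk> \<Longrightarrow> x \<oplus> y \<in> H" "\<And>x. x \<in> H \<Longrightarrow> \<ominus> x \<in> H"
    using assms(1) by (auto simp: additive_subgroup_iff)
  have "\<ominus> (p \<ominus> q) = q \<ominus> p" "\<ominus> (p \<ominus> q) = (\<ominus> p) \<ominus> (\<ominus> q)"
    using assms by (simp_all add: minus_eq minus_add a_comm)
  then show "p \<ominus> q \<in> H \<Longrightarrow> q \<ominus> p \<in> H" "p \<ominus> q \<in> H \<Longrightarrow> (\<ominus> p) \<ominus> (\<ominus> q) \<in> H"
    using H(2) by metis+
  show "p \<ominus> r \<in> H" if "r \<in> carrier G" "p \<ominus> q \<in> H" "q \<ominus> r \<in> H"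
  proof -
    have "(p \<ominus> q) \<oplus> (q \<ominus> r) = p \<oplus> ((\<ominus> q \<oplus> q) \<oplus> \<ominus> r)"
      using assms that by (simp add: minus_eq a_assoc)
    then show ?thesis using H(1)[OF that(2,3)] assms that by (simp add: l_neg minus_eq)
  qed
  show "(p \<oplus> p') \<ominus> (q \<oplus> q') \<in> H"
    if "p' \<in> carrier G" "q' \<in> carrier G" "p \<ominus> q \<in> H" "p' \<ominus> q' \<in> H"
  proof -
    have "(p \<ominus> q) \<oplus> (p' \<ominus> q') = (p \<oplus> p') \<ominus> (q \<oplus> q')"
      using assms that by (simp add: minus_eq minus_add a_ac)
    then show ?thesis using H(1)[OF that(3,4)] by simp
  qed
qed

locale dg_module_reduction = right_dg_module +
  fixes I
  assumes I: "ideal I A" and I_d: "x \<in> I \<Longrightarrow> alg_d A x \<in> I"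
begin

sublocale Ideal: ideal I A by (rule I)

abbreviation "B \<equiv> quotient_dgbimod A I"
abbreviation "relators \<equiv> tensor_relators (carrier A) P (ract P) B (lact B)"
abbreviation "null \<equiv> tensor_null (carrier A) P (ract P) B (lact B)"
abbreviation "cls \<equiv> tensor_class (carrier A) P (ract P) B (lact B)"
abbreviation "F \<equiv> tensor_free P B"
abbreviation "T \<equiv> dg_tensor A P B"
abbreviation "PI \<equiv> generated_by I"
abbreviation "D \<equiv> frag_extend
    (\<lambda>(x, b). frag_of (diff P x, b) + frag_of (sign_twist P (gr P) x, diff B b))"

lemma I_carrier: "I \<subseteq> carrier A" and PI: "additive_subgroup PI P"
  using Ideal.a_subset generated_by_additive by auto

lemma B_carrier: "carrier B = (\<lambda>a. I +>\<^bsub>A\<^esub> a) ` carrier A"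
  by (auto simp: quotient_dgbimod_def FactRing_def A_RCOSETS_def' a_r_coset_def')

lemma B_carrierI: "a \<in> carrier A \<Longrightarrow> I +>\<^bsub>A\<^esub> a \<in> carrier B"
  by (simp add: B_carrier)

lemma B_add: "\<lbrakk>a \<in> carrier A; b \<in> carrier A\<rbrakk> \<Longrightarrow> (I +>\<^bsub>A\<^esub> a) \<oplus>\<^bsub>B\<^esub> (I +>\<^bsub>A\<^esub> b) = I +>\<^bsub>A\<^esub> (a \<oplus>\<^bsub>A\<^esub> b)"
  by (simp add: quotient_dgbimod_def FactRing_def Ideal.a_rcos_sum)

lemma B_lact: "\<lbrakk>r \<in> carrier A; a \<in> carrier A\<rbrakk> \<Longrightarrow> lact B r (I +>\<^bsub>A\<^esub> a) = I +>\<^bsub>A\<^esub> (r \<otimes>\<^bsub>A\<^esub> a)"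
  by (simp add: quotient_dgbimod_def FactRing_def Ideal.rcoset_mult_add)

lemma coset_eq_iff:
  "\<lbrakk>a \<in> carrier A; b \<in> carrier A\<rbrakk> \<Longrightarrow> I +>\<^bsub>A\<^esub> a = I +>\<^bsub>A\<^esub> b \<longleftrightarrow> a \<ominus>\<^bsub>A\<^esub> b \<in> I"
  using A.quotient_eq_iff_same_a_r_cos[OF I] by blast

text \<open>The union over representatives is a single coset because \<open>I\<close> is closed
  under the differential.\<close>

lemma B_diff:
  assumes a: "a \<in> carrier A"
  shows "diff B (I +>\<^bsub>A\<^esub> a) = I +>\<^bsub>A\<^esub> alg_d A a"
proof -
  have const: "I +>\<^bsub>A\<^esub> alg_d A x = I +>\<^bsub>A\<^esub> alg_d A a" if x: "x \<in> I +>\<^bsub>A\<^esub> a" for x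
  proof -
    have xA: "x \<in> carrier A" using x a I_carrier by (auto simp: a_r_coset_def')
    have "x \<ominus>\<^bsub>A\<^esub> a \<in> I"
      using Ideal.a_repr_independence'[OF x a] coset_eq_iff xA a by metis
    then have "alg_d A (x \<ominus>\<^bsub>A\<^esub> a) \<in> I" by (rule I_d)
    then have "alg_d A x \<ominus>\<^bsub>A\<^esub> alg_d A a \<in> I"
      using xA a by (simp add: A.minus_eq alg.alg_d_add alg_d_minus[OF dg_algebra])
    then show ?thesis using coset_eq_iff xA a by simp
  qed
  have "diff B (I +>\<^bsub>A\<^esub> a) = (\<Union>x\<in>I +>\<^bsub>A\<^esub> a. I +>\<^bsub>A\<^esub> alg_d A x)"
    by (simp add: quotient_dgbimod_def)
  also have "\<dots> = (\<Union>x\<in>I +>\<^bsub>A\<^esub> a. I +>\<^bsub>A\<^esub> alg_d A a)"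
    by (rule SUP_cong[OF refl const])
  also have "\<dots> = I +>\<^bsub>A\<^esub> alg_d A a" using Ideal.a_rcos_self[OF a] by blast
  finally show ?thesis .
qed

section \<open>The tensor product with \<open>A/I\<close> and its differential\<close>

lemma comm_group_F: "comm_group F" and group_F: "group F"
  by (simp_all add: tensor_free_def abelian_free_Abelian_group)

lemma F_simps [simp]:
  "u \<in> carrier F \<longleftrightarrow> Poly_Mapping.keys u \<subseteq> carrier P \<times> carrier B"
  "monoid.mult F = (+)" "\<one>\<^bsub>F\<^esub> = 0" "Poly_Mapping.keys u \<subseteq> carrier P \<times> carrier B \<Longrightarrow> inv\<^bsub>F\<^esub> u = - u"
  by (auto simp: tensor_free_def fun_eq_iff)

lemma F_closed:
  "\<lbrakk>u \<in> carrier F; v \<in> carrier F\<rbrakk> \<Longrightarrow> u + v \<in> carrier F"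
  "\<lbrakk>u \<in> carrier F; v \<in> carrier F\<rbrakk> \<Longrightarrow> u - v \<in> carrier F"
  "u \<in> carrier F \<Longrightarrow> - u \<in> carrier F"
  "\<lbrakk>x \<in> carrier P; b \<in> carrier B\<rbrakk> \<Longrightarrow> frag_of (x, b) \<in> carrier F"
  using keys_add[of u v] keys_diff[of u v] by auto

lemma B_closed:
  "\<lbrakk>b \<in> carrier B; b' \<in> carrier B\<rbrakk> \<Longrightarrow> b \<oplus>\<^bsub>B\<^esub> b' \<in> carrier B"
  "\<lbrakk>r \<in> carrier A; b \<in> carrier B\<rbrakk> \<Longrightarrow> lact B r b \<in> carrier B"
  "b \<in> carrier B \<Longrightarrow> diff B b \<in> carrier B"
  by (auto simp: B_carrier B_add B_lact B_diff)

lemma relators_subset: "relators \<subseteq> carrier F"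
proof
  fix u assume "u \<in> relators"
  then show "u \<in> carrier F"
    unfolding tensor_relators_def
    by (elim UnE CollectE exE conjE; simp only:)
      (intro F_closed P.a_closed P.ract_closed B_closed; assumption)+
qed

lemma subgroup_null: "subgroup null F"
  unfolding tensor_null_def by (rule group.generate_is_subgroup[OF group_F relators_subset])

lemma null_closed:
  "0 \<in> null" "\<lbrakk>u \<in> null; v \<in> null\<rbrakk> \<Longrightarrow> u + v \<in> null" "u \<in> null \<Longrightarrow> - u \<in> null" "null \<subseteq> carrier F"
  using subgroup.one_closed[OF subgroup_null] subgroup.m_closed[OF subgroup_null, of u v]
    subgroup.m_inv_closed[OF subgroup_null, of u] subgroup.subset[OF subgroup_null]
  by (auto simp del: F_simps(1)) (simp add: subset_iff)

lemma relators_null: "u \<in> relators \<Longrightarrow> u \<in> null"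
  unfolding tensor_null_def by (rule generate.incl)

lemma cls_eq: "\<lbrakk>u \<in> carrier F; v \<in> carrier F; u - v \<in> null\<rbrakk> \<Longrightarrow> cls u = cls v"
proof -
  assume u: "u \<in> carrier F" and v: "v \<in> carrier F" and "u - v \<in> null"
  then have "u \<in> null #>\<^bsub>F\<^esub> v" by (auto simp: r_coset_def intro!: bexI[of _ "u - v"])
  then show ?thesis
    unfolding tensor_class_def using group.repr_independence[OF group_F _ v subgroup_null] by simp
qed

lemma cls_self: "u \<in> carrier F \<Longrightarrow> u \<in> cls u"
  unfolding tensor_class_def by (rule group.rcos_self[OF group_F _ subgroup_null])

lemma cls_eqD: "\<lbrakk>u \<in> carrier F; cls u = cls v\<rbrakk> \<Longrightarrow> u - v \<in> null"
  using cls_self[of u] by (auto simp: tensor_class_def r_coset_def)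

lemma T_simps:
  "carrier T = (\<lambda>u. cls u) ` carrier F"
  "\<zero>\<^bsub>T\<^esub> = cls 0"
  "diff T C = (\<Union>u\<in>C. cls (D u))"
  "gr T n = generate (tensor_group (carrier A) P (ract P) B (lact B))
    {cls (frag_of (x, b)) | x b. \<exists>i j. i + j = n \<and> x \<in> gr P i \<and> b \<in> gr B j}"
proof -
  have "null #>\<^bsub>F\<^esub> 0 = null"
    using group.coset_mult_one[OF group_F null_closed(4)] by simp
  then show "\<zero>\<^bsub>T\<^esub> = cls 0"
    by (simp add: dg_tensor_def Let_def tensor_group_def FactGroup_def tensor_class_def)
qed (auto simp: dg_tensor_def Let_def tensor_group_def carrier_FactGroup tensor_class_def)

lemma D_closed: "u \<in> carrier F \<Longrightarrow> D u \<in> carrier F"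
proof -
  assume u: "u \<in> carrier F"
  have "Poly_Mapping.keys (frag_of (diff P x, b) + frag_of (sign_twist P (gr P) x, diff B b))
      \<subseteq> carrier P \<times> carrier B" if "(x, b) \<in> Poly_Mapping.keys u" for x b
  proof -
    have "x \<in> carrier P" "b \<in> carrier B" using that u by auto
    then show ?thesis
      using F_closed(1)[OF F_closed(4)[of "diff P x" b] F_closed(4)[of "sign_twist P (gr P) x" "diff B b"]]
        B_closed(3) by simp
  qed
  then have "(\<Union>p\<in>Poly_Mapping.keys u. Poly_Mapping.keys ((\<lambda>(x, b). frag_of (diff P x, b) +
      frag_of (sign_twist P (gr P) x, diff B b)) p)) \<subseteq> carrier P \<times> carrier B"
    by (intro UN_least) (simp only: split_paired_all prod.case)
  then show ?thesis unfolding F_simps(1) by (rule subset_trans[OF keys_frag_extend])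
qed

text \<open>
  That \<open>d\<close> respects the relations of the tensor product need not be checked: the union defining
  \<open>d (cls u)\<close> contains \<open>cls (D u)\<close> and, \<open>T\<close> being closed under \<open>d\<close>, is a single coset.
\<close>

lemma T_diff_cls:
  assumes T: "dg_module A T" and u: "u \<in> carrier F"
  shows "diff T (cls u) = cls (D u)"
proof -
  have "cls u \<in> carrier T" using u by (simp only: T_simps image_eqI)
  then have "diff T (cls u) \<in> carrier T" by (rule dg_module.diff_closed[OF T])
  then obtain w where w: "w \<in> carrier F" "diff T (cls u) = cls w" by (auto simp only: T_simps(1))
  have "D u \<in> diff T (cls u)"
    unfolding T_simps(3)
    by (rule UN_I[where a = u and B = "\<lambda>u. cls (D u)"]) (rule cls_self[OF u], rule cls_self[OF D_closed[OF u]])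
  then have "D u \<in> null #>\<^bsub>F\<^esub> w" unfolding w(2) unfolding tensor_class_def .
  then show ?thesis
    unfolding w(2) unfolding tensor_class_def by (rule group.repr_independence[OF group_F _ w(1) subgroup_null])
qed

text \<open>The coset \<open>I\<close> is the zero of \<open>A/I\<close>, and the biadditivity
  relator for \<open>I \<oplus> I = I\<close> is exactly minus the generator
  \<open>(x, I)\<close>.\<close>

lemma frag_null:
  assumes x: "x \<in> carrier P"
  shows "frag_of (x, I) \<in> null"
proof -
  have z: "I +>\<^bsub>A\<^esub> \<zero>\<^bsub>A\<^esub> = I" using I_carrier by simp
  then have "I \<in> carrier B" "I \<oplus>\<^bsub>B\<^esub> I = I" using B_carrierI[of "\<zero>\<^bsub>A\<^esub>"] B_add[of "\<zero>\<^bsub>A\<^esub>" "\<zero>\<^bsub>A\<^esub>"] by auto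
  then have "frag_of (x, I) - frag_of (x, I) - frag_of (x, I) \<in> relators"
    using x unfolding tensor_relators_def by (auto intro!: exI[of _ x] exI[of _ I])
  then show ?thesis using null_closed(3)[OF relators_null] by fastforce
qed

text \<open>The map from \<open>P\<close> to the tensor product sending \<open>x\<close> to
  \<open>x\<close> tensor \<open>1\<close> kills \<open>PI\<close>: the factor \<open>s\<close> of
  \<open>x s\<close> moves across the tensor sign, where it becomes zero in
  \<open>A/I\<close>.\<close>

lemma frag_PI_null:
  assumes "x \<in> PI"
  shows "frag_of (x, I +>\<^bsub>A\<^esub> \<one>\<^bsub>A\<^esub>) \<in> null"
  using assms I_carrier
proof (induction rule: generated_by_induct)
  case zero
  let ?b = "I +>\<^bsub>A\<^esub> \<one>\<^bsub>A\<^esub>"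
  have "frag_of (\<zero>\<^bsub>P\<^esub> \<oplus>\<^bsub>P\<^esub> \<zero>\<^bsub>P\<^esub>, ?b) - frag_of (\<zero>\<^bsub>P\<^esub>, ?b) - frag_of (\<zero>\<^bsub>P\<^esub>, ?b) \<in> relators"
    unfolding tensor_relators_def using B_carrierI[OF A.one_closed] P.zero_closed by blast
  then show ?case using null_closed(3)[OF relators_null] by fastforce
next
  case (ract x s)
  let ?b = "I +>\<^bsub>A\<^esub> \<one>\<^bsub>A\<^esub>"
  have s: "s \<in> carrier A" using ract I_carrier by auto
  have "lact B s ?b = I"
    using s ract(2) B_lact[OF s A.one_closed] A.a_coset_join2 Ideal.a_subgroup by simp
  moreover have "frag_of (ract P x s, ?b) - frag_of (x, lact B s ?b) \<in> relators"
    unfolding tensor_relators_def using B_carrierI[OF A.one_closed] ract s by blast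
  ultimately have "frag_of (ract P x s, ?b) - frag_of (x, I) \<in> null"
    using relators_null by metis
  then show ?case using null_closed(2) frag_null[OF ract(1)] by fastforce
next
  case (add x y)
  let ?b = "I +>\<^bsub>A\<^esub> \<one>\<^bsub>A\<^esub>"
  have "frag_of (x \<oplus>\<^bsub>P\<^esub> y, ?b) - frag_of (x, ?b) - frag_of (y, ?b) \<in> relators"
    unfolding tensor_relators_def using B_carrierI[OF A.one_closed] add by blast
  then have "(frag_of (x \<oplus>\<^bsub>P\<^esub> y, ?b) - frag_of (x, ?b) - frag_of (y, ?b)) + (frag_of (x, ?b) + frag_of (y, ?b)) \<in> null"
    using null_closed(2) relators_null add by blast
  then show ?case by (simp add: algebra_simps)
qed

section \<open>Evaluation of tensors in \<open>P\<close> modulo \<open>PI\<close>\<close>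

definition rep :: "'b set \<Rightarrow> 'b" where "rep C = (SOME a. a \<in> C)"

lemma rep:
  assumes "C \<in> carrier B" shows "rep C \<in> carrier A" "I +>\<^bsub>A\<^esub> rep C = C"
proof -
  obtain a where a: "a \<in> carrier A" "C = I +>\<^bsub>A\<^esub> a" using assms by (auto simp: B_carrier)
  then have "a \<in> C" using Ideal.a_rcos_self by simp
  then have mem: "rep C \<in> C" unfolding rep_def by (rule someI)
  then show "rep C \<in> carrier A"
    using a I_carrier by (auto simp: a_r_coset_def')
  show "I +>\<^bsub>A\<^esub> rep C = C"
    using mem Ideal.a_repr_independence'[of "rep C" a] a by simp
qed

lemma ract_coset:
  assumes "x \<in> carrier P" "a \<in> carrier A" "b \<in> carrier A" "I +>\<^bsub>A\<^esub> a = I +>\<^bsub>A\<^esub> b"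
  shows "ract P x a \<ominus>\<^bsub>P\<^esub> ract P x b \<in> PI"
proof -
  have "ract P x (a \<ominus>\<^bsub>A\<^esub> b) \<in> PI"
    using assms coset_eq_iff generated_by_mem(6)[OF I_carrier] by simp
  then show ?thesis using assms by (simp add: A.minus_eq P.minus_eq P.ract_add_right ract_minus)
qed

text \<open>Modulo \<open>PI\<close> this inverts the map sending \<open>x\<close> to
  \<open>x\<close> tensor \<open>1\<close>. It is defined on the free abelian group, where
  additivity costs nothing although the choice \<open>rep\<close> is neither additive nor
  multiplicative.\<close>

lemma exists_evaluation:
  obtains h where "h \<in> hom F (add_monoid P)"
    "\<And>x b. \<lbrakk>x \<in> carrier P; b \<in> carrier B\<rbrakk> \<Longrightarrow> h (frag_of (x, b)) = ract P x (rep b)"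
proof -
  have "(\<lambda>(x, b). ract P x (rep b)) ` (carrier P \<times> carrier B) \<subseteq> carrier (add_monoid P)"
    using rep(1) by auto
  then obtain h where "h \<in> hom (free_Abelian_group (carrier P \<times> carrier B)) (add_monoid P)"
    "\<And>x. x \<in> carrier P \<times> carrier B \<Longrightarrow> h (frag_of x) = (\<lambda>(x, b). ract P x (rep b)) x"
    using comm_group.free_Abelian_group_universal[OF P.a_comm_group] by metis
  then show ?thesis using that by (auto simp: tensor_free_def)
qed

context
  fixes h
  assumes h: "h \<in> hom F (add_monoid P)"
    and evaluation_frag: "\<And>x b. \<lbrakk>x \<in> carrier P; b \<in> carrier B\<rbrakk> \<Longrightarrow> h (frag_of (x, b)) = ract P x (rep b)"
begin

lemma evaluation_closed: "u \<in> carrier F \<Longrightarrow> h u \<in> carrier P"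
  using hom_in_carrier[OF h] by simp

lemma evaluation_add: "\<lbrakk>u \<in> carrier F; v \<in> carrier F\<rbrakk> \<Longrightarrow> h (u + v) = h u \<oplus>\<^bsub>P\<^esub> h v"
  using hom_mult[OF h] by simp

lemma evaluation_zero: "h 0 = \<zero>\<^bsub>P\<^esub>"
  using hom_one[OF h group_F P.a_group] by simp

lemma evaluation_minus: "u \<in> carrier F \<Longrightarrow> h (- u) = \<ominus>\<^bsub>P\<^esub> h u"
  using group_hom.hom_inv[of F "add_monoid P" h u] h group_F P.a_group
  by (simp add: group_hom_def group_hom_axioms_def a_inv_def)

lemma evaluation_diff: "\<lbrakk>u \<in> carrier F; v \<in> carrier F\<rbrakk> \<Longrightarrow> h (u - v) = h u \<ominus>\<^bsub>P\<^esub> h v"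
  using evaluation_add[of u "- v"] evaluation_minus[of v] F_closed(3)[of v] by (simp add: P.minus_eq)

text \<open>Additivity on the left holds exactly, as all three terms use the same representative. In
  the other two relations the representatives agree only modulo \<open>I\<close>, which leaves an
  error in \<open>PI\<close>.\<close>

lemma evaluation_relators:
  assumes "u \<in> relators" shows "h u \<in> PI"
proof -
  note G = generated_by_mem[OF I_carrier]
  consider (left) x x' b where "u = frag_of (x \<oplus>\<^bsub>P\<^esub> x', b) - frag_of (x, b) - frag_of (x', b)"
      "x \<in> carrier P" "x' \<in> carrier P" "b \<in> carrier B"
    | (right) x b b' where "u = frag_of (x, b \<oplus>\<^bsub>B\<^esub> b') - frag_of (x, b) - frag_of (x, b')"
      "x \<in> carrier P" "b \<in> carrier B" "b' \<in> carrier B"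
    | (balance) x r b where "u = frag_of (ract P x r, b) - frag_of (x, lact B r b)"
      "x \<in> carrier P" "r \<in> carrier A" "b \<in> carrier B"
    using assms unfolding tensor_relators_def by blast
  then show ?thesis
  proof cases
    case left
    have "h u = (ract P x (rep b) \<oplus>\<^bsub>P\<^esub> ract P x' (rep b)) \<ominus>\<^bsub>P\<^esub> ract P x (rep b) \<ominus>\<^bsub>P\<^esub> ract P x' (rep b)"
      using left rep(1) by (simp add: evaluation_diff evaluation_frag F_closed P.ract_add_left del: F_simps(1))
    also have "\<dots> = \<zero>\<^bsub>P\<^esub>"
      using left rep(1)[OF left(4)] P.add_minus_add_cancel[of "ract P x (rep b)" "ract P x' (rep b)" "\<zero>\<^bsub>P\<^esub>"]
      by (simp add: P.minus_eq P.r_neg)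
    finally show ?thesis using G(2) by simp
  next
    case right
    let ?b = "b \<oplus>\<^bsub>B\<^esub> b'"
    have b: "rep b \<in> carrier A" "rep b' \<in> carrier A" "rep ?b \<in> carrier A" "?b \<in> carrier B"
      using rep(1) right B_closed by auto
    have "I +>\<^bsub>A\<^esub> rep ?b = I +>\<^bsub>A\<^esub> (rep b \<oplus>\<^bsub>A\<^esub> rep b')"
      using B_add[OF b(1,2)] rep(2)[OF right(3)] rep(2)[OF right(4)] rep(2)[OF b(4)] by simp
    then have "ract P x (rep ?b) \<ominus>\<^bsub>P\<^esub> ract P x (rep b \<oplus>\<^bsub>A\<^esub> rep b') \<in> PI"
      using ract_coset right b by simp
    moreover have "h u = ract P x (rep ?b) \<ominus>\<^bsub>P\<^esub> ract P x (rep b) \<ominus>\<^bsub>P\<^esub> ract P x (rep b')"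
      using right b by (simp add: evaluation_diff evaluation_frag F_closed del: F_simps(1))
    ultimately show ?thesis
      using right b by (simp add: P.ract_add_right P.minus_eq P.minus_add P.a_assoc)
  next
    case balance
    have b: "rep b \<in> carrier A" "rep (lact B r b) \<in> carrier A" "lact B r b \<in> carrier B"
      using rep(1) balance B_closed by auto
    have "I +>\<^bsub>A\<^esub> (r \<otimes>\<^bsub>A\<^esub> rep b) = I +>\<^bsub>A\<^esub> rep (lact B r b)"
      using B_lact[OF balance(3) b(1)] rep(2)[OF balance(4)] rep(2)[OF b(3)] by simp
    then have "ract P x (r \<otimes>\<^bsub>A\<^esub> rep b) \<ominus>\<^bsub>P\<^esub> ract P x (rep (lact B r b)) \<in> PI"
      using ract_coset balance b by simp
    then show ?thesis
      using balance b by (simp add: evaluation_diff evaluation_frag F_closed P.ract_mult del: F_simps(1))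
  qed
qed

lemma evaluation_null:
  assumes "u \<in> null" shows "h u \<in> PI"
proof -
  note G = generated_by_mem[OF I_carrier]
  have "u \<in> carrier F \<and> h u \<in> PI" using assms unfolding tensor_null_def
  proof (induction rule: generate.induct)
    case one
    then show ?case using G(2) evaluation_zero by simp
  next
    case (incl u)
    then show ?case using evaluation_relators relators_subset by blast
  next
    case (inv u)
    then have "u \<in> carrier F" "h u \<in> PI" using evaluation_relators relators_subset by blast+
    then show ?case using G(4) evaluation_minus F_closed(3)[of u] by simp
  next
    case (eng u v)
    then show ?case using G(3) evaluation_add F_closed(1)[of u v] by simp
  qed
  then show ?thesis ..
qed

lemma evaluation_cls_eq:
  assumes "u \<in> carrier F" "v \<in> carrier F" "cls u = cls v"
  shows "h u \<ominus>\<^bsub>P\<^esub> h v \<in> PI"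
  using evaluation_null[OF cls_eqD[OF assms(1,3)]] assms by (simp only: evaluation_diff)

lemma evaluation_frag_coset:
  assumes "x \<in> carrier P" "a \<in> carrier A"
  shows "h (frag_of (x, I +>\<^bsub>A\<^esub> a)) \<ominus>\<^bsub>P\<^esub> ract P x a \<in> PI"
proof -
  have b: "I +>\<^bsub>A\<^esub> a \<in> carrier B" using assms B_carrierI by blast
  show ?thesis using ract_coset[OF assms(1) rep(1)[OF b] assms(2) rep(2)[OF b]] evaluation_frag[OF assms(1) b] by simp
qed

text \<open>The sign twist in \<open>D\<close> is the sign in the Leibniz rule for
  \<open>x a\<close>, so both expressions have the same two terms up to the representatives chosen
  for the cosets of \<open>a\<close> and \<open>d a\<close>.\<close>

lemma evaluation_D_homogeneous:
  assumes x: "x \<in> gr P i" and a: "a \<in> carrier A"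
  shows "h (D (frag_of (x, I +>\<^bsub>A\<^esub> a))) \<ominus>\<^bsub>P\<^esub> diff P (ract P x a) \<in> PI"
proof -
  have xP: "x \<in> carrier P" using x PG.gr_mem(1) by blast
  let ?s = "sign_by P i x"
  have s: "?s \<in> carrier P" using xP by simp
  have b: "I +>\<^bsub>A\<^esub> a \<in> carrier B" "I +>\<^bsub>A\<^esub> alg_d A a \<in> carrier B" using a B_carrierI by auto
  have "D (frag_of (x, I +>\<^bsub>A\<^esub> a)) = frag_of (diff P x, I +>\<^bsub>A\<^esub> a) + frag_of (?s, I +>\<^bsub>A\<^esub> alg_d A a)"
    using x a by (simp add: PG.sign_twist_homogeneous B_diff)
  then have "h (D (frag_of (x, I +>\<^bsub>A\<^esub> a))) =
      h (frag_of (diff P x, I +>\<^bsub>A\<^esub> a)) \<oplus>\<^bsub>P\<^esub> h (frag_of (?s, I +>\<^bsub>A\<^esub> alg_d A a))"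
    using evaluation_add[OF F_closed(4) F_closed(4)] b s xP by simp
  moreover have "diff P (ract P x a) = ract P (diff P x) a \<oplus>\<^bsub>P\<^esub> ract P ?s (alg_d A a)"
    using P.Leibniz[OF x a] xP a by (simp add: sign_by_def ract_minus)
  ultimately show ?thesis
    using P.subgroup_cong_add[OF PI _ _ _ _ evaluation_frag_coset evaluation_frag_coset] evaluation_closed[OF F_closed(4)]
      b s xP a by simp
qed

text \<open>Components of the tensor product are known only through generators, so the witness
  \<open>w\<close> is built along the generation. For \<open>x\<close> tensor \<open>b\<close> it is
  \<open>x a\<close> with \<open>a\<close> a homogeneous lift of \<open>b\<close>; the evaluation
  itself would not serve, as \<open>rep b\<close> may be inhomogeneous.\<close>

lemma T_gr_representative:
  assumes "t \<in> gr T m"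
  shows "\<exists>u\<in>carrier F. t = cls u \<and> (\<exists>w\<in>gr P m. h (D u) \<ominus>\<^bsub>P\<^esub> diff P w \<in> PI)"
proof -
  interpret N: normal null F
    using comm_group.subgroup_imp_normal[OF comm_group_F subgroup_null] .
  note G = generated_by_mem[OF I_carrier]
  let ?T = "tensor_group (carrier A) P (ract P) B (lact B)"
  let ?Q = "\<lambda>t u w. u \<in> carrier F \<and> t = cls u \<and> w \<in> gr P m \<and> h (D u) \<ominus>\<^bsub>P\<^esub> diff P w \<in> PI"
  have hom: "\<exists>u w. ?Q t u w" if "t \<in> {cls (frag_of (x, b)) | x b. \<exists>i j. i + j = m \<and> x \<in> gr P i \<and> b \<in> gr B j}" for t
  proof -
    obtain x b i j where t: "t = cls (frag_of (x, b))" "i + j = m" "x \<in> gr P i" "b \<in> gr B j"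
      using \<open>t \<in> _\<close> by blast
    then obtain a where a: "a \<in> alg_gr A j" "b = I +>\<^bsub>A\<^esub> a" by (auto simp: quotient_dgbimod_def)
    have aA: "a \<in> carrier A" using a AG.gr_mem(1) by blast
    have xP: "x \<in> carrier P" using t PG.gr_mem(1) by blast
    have "frag_of (x, b) \<in> carrier F" using F_closed(4)[OF xP] B_carrierI[OF aA] a by simp
    moreover have "ract P x a \<in> gr P m" using P.ract_gr[OF t(3) a(1)] t(2) by simp
    ultimately show ?thesis using t(1) evaluation_D_homogeneous[OF t(3) aA] a(2) by blast
  qed
  have "\<exists>u w. ?Q t u w" using assms unfolding T_simps(4)
  proof (induction rule: generate.induct)
    case one
    have "cls 0 = null" using group.coset_mult_one[OF group_F null_closed(4)]
      by (simp add: tensor_class_def)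
    then have "?Q \<one>\<^bsub>?T\<^esub> 0 \<zero>\<^bsub>P\<^esub>"
      using G(2) PG.gr_mem(2) evaluation_zero by (simp add: tensor_group_def FactGroup_def P.minus_eq)
    then show ?case by blast
  next
    case (incl t)
    then show ?case by (rule hom)
  next
    case (inv t)
    then obtain u w where uw: "?Q t u w" using hom by blast
    then have c: "u \<in> carrier F" "w \<in> carrier P" using PG.gr_mem(1)[of w m] by (simp_all only:)
    have "t \<in> carrier ?T" using uw by (auto simp: tensor_group_def carrier_FactGroup tensor_class_def)
    then have "inv\<^bsub>?T\<^esub> t = cls (- u)"
      using N.inv_FactGroup[of t] N.rcos_inv[of u] uw by (simp add: tensor_group_def tensor_class_def)
    moreover have "h (D (- u)) = \<ominus>\<^bsub>P\<^esub> h (D u)"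
      using evaluation_minus[OF D_closed] uw by (simp add: frag_extend_minus)
    moreover have "diff P (\<ominus>\<^bsub>P\<^esub> w) = \<ominus>\<^bsub>P\<^esub> diff P w" by (rule diff_minus[OF c(2)])
    moreover have "h (D u) \<in> carrier P" "diff P w \<in> carrier P"
      by (fact evaluation_closed[OF D_closed[OF c(1)]] P.diff_closed[OF c(2)])+
    ultimately have "?Q (inv\<^bsub>?T\<^esub> t) (- u) (\<ominus>\<^bsub>P\<^esub> w)"
      using uw P.subgroup_cong_minus[OF PI, of "h (D u)" "diff P w"] PG.gr_mem(4)[of w m] F_closed(3)[of u]
      by (simp only:)
    then show ?case by blast
  next
    case (eng t t')
    then obtain u w u' w' where uw: "?Q t u w" "?Q t' u' w'" by blast
    then have c: "u \<in> carrier F" "w \<in> carrier P" "u' \<in> carrier F" "w' \<in> carrier P"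
      using PG.gr_mem(1)[of w m] PG.gr_mem(1)[of w' m] by (simp_all only:)
    have "t \<otimes>\<^bsub>?T\<^esub> t' = cls (u + u')"
      using N.rcos_sum[of u u'] uw by (simp add: tensor_group_def tensor_class_def FactGroup_def)
    moreover have "h (D (u + u')) = h (D u) \<oplus>\<^bsub>P\<^esub> h (D u')"
      using evaluation_add[OF D_closed D_closed] uw by (simp add: frag_extend_add)
    moreover have "diff P (w \<oplus>\<^bsub>P\<^esub> w') = diff P w \<oplus>\<^bsub>P\<^esub> diff P w'"
      by (rule P.diff_add[OF c(2,4)])
    moreover have "h (D u) \<in> carrier P" "diff P w \<in> carrier P" "h (D u') \<in> carrier P" "diff P w' \<in> carrier P"
      by (fact evaluation_closed[OF D_closed[OF c(1)]] P.diff_closed[OF c(2)]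
          evaluation_closed[OF D_closed[OF c(3)]] P.diff_closed[OF c(4)])+
    ultimately have "?Q (t \<otimes>\<^bsub>?T\<^esub> t') (u + u') (w \<oplus>\<^bsub>P\<^esub> w')"
      using uw P.subgroup_cong_add[OF PI, of "h (D u)" "diff P w" "h (D u')" "diff P w'"]
        PG.gr_mem(3)[of w m w'] F_closed(1)[of u u'] by (simp only:)
    then show ?case by blast
  qed
  then show ?thesis by blast
qed

end

text \<open>Because \<open>d y\<close> is in \<open>PI\<close> and
  \<open>d \<one> = \<zero>\<close>, the tensor of \<open>y\<close> with the class of
  \<open>1\<close> is a cocycle. Acyclicity makes it a coboundary, and evaluation carries this back
  to \<open>P\<close> modulo \<open>PI\<close>.\<close>

lemma acyclic_reduction:
  assumes T: "dg_module A T"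
    and acyclic: "\<And>n t. \<lbrakk>t \<in> gr T n; diff T t = \<zero>\<^bsub>T\<^esub>\<rbrakk> \<Longrightarrow> t \<in> diff T ` gr T (n - 1)"
    and y: "y \<in> gr P n" "diff P y \<in> PI"
  shows "\<exists>w\<in>gr P (n - 1). y \<ominus>\<^bsub>P\<^esub> diff P w \<in> PI"
proof -
  obtain h where h: "h \<in> hom F (add_monoid P)"
    "\<And>x b. \<lbrakk>x \<in> carrier P; b \<in> carrier B\<rbrakk> \<Longrightarrow> h (frag_of (x, b)) = ract P x (rep b)"
    using exists_evaluation by blast
  let ?b = "I +>\<^bsub>A\<^esub> \<one>\<^bsub>A\<^esub>"
  let ?y = "frag_of (y, ?b)"
  have yP: "y \<in> carrier P" using y PG.gr_mem(1) by blast
  have b: "?b \<in> carrier B" "diff B ?b = I"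
    using B_carrierI B_diff[OF A.one_closed] alg_d_one[OF dg_algebra] I_carrier by auto
  have yF: "?y \<in> carrier F" using F_closed(4)[OF yP b(1)] .
  have "?b \<in> gr B 0" using alg.alg_one_gr by (simp add: quotient_dgbimod_def)
  then have gr: "cls ?y \<in> gr T n"
    unfolding T_simps(4) using y(1) by (intro generate.incl) force
  have Dy: "D ?y = frag_of (diff P y, ?b) + frag_of (sign_twist P (gr P) y, I)" by (simp add: b(2))
  have "D ?y \<in> null"
    unfolding Dy using frag_PI_null[OF y(2)] frag_null yP by (intro null_closed(2)) simp_all
  then have "cls (D ?y) = cls 0"
    using cls_eq[OF D_closed[OF yF], of 0] by simp
  then have "diff T (cls ?y) = \<zero>\<^bsub>T\<^esub>" using T_diff_cls[OF T yF] by (simp only: T_simps(2))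
  then obtain t where t: "t \<in> gr T (n - 1)" "cls ?y = diff T t" using acyclic[OF gr] by blast
  obtain u w where u: "u \<in> carrier F" "t = cls u" and w: "w \<in> gr P (n - 1)" "h (D u) \<ominus>\<^bsub>P\<^esub> diff P w \<in> PI"
    using T_gr_representative[OF h t(1)] by blast
  have "cls ?y = cls (D u)" using t u T_diff_cls[OF T u(1)] by simp
  \<comment> \<open>The chain of congruences modulo \<open>PI\<close> runs from \<open>y\<close>
    through \<open>h ?y\<close> and \<open>h (D u)\<close> to \<open>d w\<close>.\<close>
  then have 1: "h ?y \<ominus>\<^bsub>P\<^esub> h (D u) \<in> PI" using evaluation_cls_eq[OF h yF D_closed[OF u(1)]] by blast
  have 2: "h ?y \<ominus>\<^bsub>P\<^esub> y \<in> PI"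
    using evaluation_frag_coset[OF h yP A.one_closed] yP by (simp add: P.ract_one)
  have c: "h ?y \<in> carrier P" "h (D u) \<in> carrier P" "diff P w \<in> carrier P"
    using evaluation_closed[OF h] yF D_closed[OF u(1)] PG.gr_mem(1)[OF w(1)] by auto
  have "y \<ominus>\<^bsub>P\<^esub> h ?y \<in> PI" using P.subgroup_cong_sym[OF PI c(1) yP 2] .
  then have "y \<ominus>\<^bsub>P\<^esub> h (D u) \<in> PI" using P.subgroup_cong_trans[OF PI yP c(1) c(2)] 1 by blast
  then have "y \<ominus>\<^bsub>P\<^esub> diff P w \<in> PI" using P.subgroup_cong_trans[OF PI yP c(2) c(3)] w(2) by blast
  then show ?thesis using w(1) by blast
qed

end

section \<open>Acyclicity\<close>

text \<open>The class of zero is always present, so a singleton means vanishing cohomology. In this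
  form vanishing can be transported along the bijections that \<open>quasi_iso\<close>
  provides.\<close>

lemma (in right_dg_module) trivial_cohomology_iff:
  "(\<exists>c. cohomology P i = {c}) \<longleftrightarrow>
    (\<forall>x\<in>gr P i. diff P x = \<zero>\<^bsub>P\<^esub> \<longrightarrow> x \<in> diff P ` gr P (i - 1))"
proof -
  let ?C = "diff P ` gr P (i - 1)"
  have C: "additive_subgroup ?C P"
    unfolding P.additive_subgroup_iff
  proof (intro conjI ballI)
    show "?C \<subseteq> carrier P" using PG.gr_mem(1) by auto
    show "\<zero>\<^bsub>P\<^esub> \<in> ?C" using PG.gr_mem(2) by (intro image_eqI[of _ _ "\<zero>\<^bsub>P\<^esub>"]) auto
  next
    fix x y assume "x \<in> ?C" "y \<in> ?C"
    then obtain u v where "x = diff P u" "y = diff P v" "u \<in> gr P (i - 1)" "v \<in> gr P (i - 1)" by auto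
    then have "x \<oplus>\<^bsub>P\<^esub> y = diff P (u \<oplus>\<^bsub>P\<^esub> v)" "u \<oplus>\<^bsub>P\<^esub> v \<in> gr P (i - 1)"
      using PG.gr_mem(1)[of u] PG.gr_mem(1)[of v] PG.gr_mem(3) by (simp_all add: P.diff_add)
    then show "x \<oplus>\<^bsub>P\<^esub> y \<in> ?C" by (rule image_eqI)
  next
    fix x assume "x \<in> ?C"
    then obtain u where "x = diff P u" "u \<in> gr P (i - 1)" by auto
    then have "\<ominus>\<^bsub>P\<^esub> x = diff P (\<ominus>\<^bsub>P\<^esub> u)" "\<ominus>\<^bsub>P\<^esub> u \<in> gr P (i - 1)"
      using PG.gr_mem(1)[of u] PG.gr_mem(4) by (simp_all add: diff_minus)
    then show "\<ominus>\<^bsub>P\<^esub> x \<in> ?C" by (rule image_eqI)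
  qed
  then have sub: "subgroup ?C (add_monoid P)" by (rule additive_subgroup.a_subgroup)
  have cohomology: "cohomology P i = (\<lambda>x. ?C +>\<^bsub>P\<^esub> x) ` {x \<in> gr P i. diff P x = \<zero>\<^bsub>P\<^esub>}"
    by (simp add: cohomology_def cocycles_def coboundaries_def)
  have zero: "\<zero>\<^bsub>P\<^esub> \<in> {x \<in> gr P i. diff P x = \<zero>\<^bsub>P\<^esub>}" using PG.gr_mem(2) by simp
  have C0: "?C +>\<^bsub>P\<^esub> \<zero>\<^bsub>P\<^esub> = ?C"
    using additive_subgroup.a_subset[OF C] by (rule P.a_coset_add_zero)
  show ?thesis
  proof
    assume "\<exists>c. cohomology P i = {c}"
    then obtain c where c: "cohomology P i = {c}" ..
    have const: "?C +>\<^bsub>P\<^esub> x = c" if "x \<in> {x \<in> gr P i. diff P x = \<zero>\<^bsub>P\<^esub>}" for x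
      using imageI[OF that, of "\<lambda>x. ?C +>\<^bsub>P\<^esub> x"] unfolding cohomology[symmetric] c by (rule singletonD)
    have eq: "?C +>\<^bsub>P\<^esub> x = ?C" if "x \<in> gr P i" "diff P x = \<zero>\<^bsub>P\<^esub>" for x
      using const[of x] const[OF zero] C0 that by simp
    show "\<forall>x\<in>gr P i. diff P x = \<zero>\<^bsub>P\<^esub> \<longrightarrow> x \<in> ?C"
    proof (intro ballI impI)
      fix x assume x: "x \<in> gr P i" "diff P x = \<zero>\<^bsub>P\<^esub>"
      have "\<zero>\<^bsub>P\<^esub> \<oplus>\<^bsub>P\<^esub> x \<in> ?C +>\<^bsub>P\<^esub> x"
        using C P.additive_subgroup_iff by (auto simp: a_r_coset_def')
      then show "x \<in> ?C" using eq[OF x] PG.gr_mem(1)[OF x(1)] by simp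
    qed
  next
    assume *: "\<forall>x\<in>gr P i. diff P x = \<zero>\<^bsub>P\<^esub> \<longrightarrow> x \<in> ?C"
    have "?C +>\<^bsub>P\<^esub> x = ?C" if "x \<in> {x \<in> gr P i. diff P x = \<zero>\<^bsub>P\<^esub>}" for x
      using that * PG.gr_mem(1) by (intro P.a_coset_join2 sub) auto
    then have "cohomology P i = (\<lambda>x. ?C) ` {x \<in> gr P i. diff P x = \<zero>\<^bsub>P\<^esub>}"
      unfolding cohomology by (rule image_cong[OF refl])
    then show "\<exists>c. cohomology P i = {c}" using zero by blast
  qed
qed

lemma bij_betw_singleton_iff:
  assumes "bij_betw f X Y" shows "(\<exists>x. X = {x}) \<longleftrightarrow> (\<exists>y. Y = {y})"
  using bij_betw_same_card[OF assms] by (metis card_1_singletonE is_singletonI is_singleton_altdef)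

section \<open>Isomorphism with zero in the derived category\<close>

lemma abelian_group_zero_dgmod: "abelian_group zero_dgmod"
  by (rule abelian_groupI) (auto simp: zero_dgmod_def)

lemma dg_module_zero_dgmod: "dg_module A (zero_dgmod :: ('a, 'm) dgmod)"
proof -
  interpret abelian_group "zero_dgmod :: ('a, 'm) dgmod" by (rule abelian_group_zero_dgmod)
  let ?Z = "zero_dgmod :: ('a, 'm) dgmod"
  have Z: "carrier ?Z = {undefined}" "\<zero>\<^bsub>?Z\<^esub> = undefined" "\<And>i. gr ?Z i = {undefined}"
    "\<And>x. diff ?Z x = undefined" "\<And>x a. ract ?Z x a = undefined" "\<And>x y. x \<oplus>\<^bsub>?Z\<^esub> y = undefined"
    by (simp_all add: zero_dgmod_def)
  have neg: "\<ominus>\<^bsub>?Z\<^esub> undefined = undefined" using a_inv_closed[of undefined] Z by simp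
  have sub: "additive_subgroup {undefined} ?Z"
    unfolding additive_subgroup_iff using Z neg by auto
  have "grading ?Z (gr ?Z)"
    unfolding grading_def
  proof (intro conjI allI ballI)
    show "additive_subgroup (gr ?Z i) ?Z" for i using sub Z by simp
    fix x assume "x \<in> carrier ?Z"
    then have x: "x = \<zero>\<^bsub>?Z\<^esub>" using Z by simp
    show "\<exists>!c. homogeneous_decomposition ?Z (gr ?Z) x c"
    proof (rule ex1I[of _ "\<lambda>_. undefined"])
      show "homogeneous_decomposition ?Z (gr ?Z) x (\<lambda>_. undefined)"
        using finsum_empty by (simp add: homogeneous_decomposition_def Z x)
      show "c = (\<lambda>_. undefined)" if "homogeneous_decomposition ?Z (gr ?Z) x c" for c
        using that by (auto simp: homogeneous_decomposition_def Z)
    qed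
  qed
  then show ?thesis
    by unfold_locales (auto simp: Z sign_by_def neg)
qed

lemma cohomology_zero_dgmod: "cohomology zero_dgmod i = {{undefined}}"
  by (simp add: cohomology_def cocycles_def coboundaries_def zero_dgmod_def a_r_coset_def')

text \<open>Every link of the zigzag, in either direction, is a bijection on cohomology, so the
  singletons spread from the zero module. The first conjunct is how a tensor product that is
  isomorphic to zero is recognised as a DG module.\<close>

lemma derived_iso_zero_imp:
  assumes "derived_iso A M zero_dgmod"
  shows "dg_module A M \<and> (\<forall>i. \<exists>c. cohomology M i = {c})"
  using assms unfolding derived_iso_def
proof (induction rule: converse_equivclp_induct)
  case base
  show ?case by (simp add: dg_module_zero_dgmod cohomology_zero_dgmod)
next
  case (step M N)
  have "dg_module A M" using step.hyps(1) by blast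
  moreover have "\<exists>c. cohomology M i = {c}" for i
  proof -
    obtain f where "quasi_iso A M N f \<or> quasi_iso A N M f" using step.hyps(1) by blast
    then show ?thesis
    proof
      assume "quasi_iso A M N f"
      then have bij: "bij_betw (cohomology_map N f i) (cohomology M i) (cohomology N i)"
        by (simp add: quasi_iso_def)
      show ?thesis unfolding bij_betw_singleton_iff[OF bij] using step.IH by blast
    next
      assume "quasi_iso A N M f"
      then have bij: "bij_betw (cohomology_map M f i) (cohomology N i) (cohomology M i)"
        by (simp add: quasi_iso_def)
      show ?thesis unfolding bij_betw_singleton_iff[OF bij, symmetric] using step.IH by blast
    qed
  qed
  ultimately show ?case by blast
qed

text \<open>A single link suffices: on cohomology the map to the zero module is a map between
  singletons.\<close>

lemma derived_iso_zeroI: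
  fixes M :: "('a, 'm) dgmod"
  assumes M: "dg_module A M" and acyclic: "\<And>i. \<exists>c. cohomology M i = {c}"
  shows "derived_iso A M zero_dgmod"
proof -
  let ?Z = "zero_dgmod :: ('a, 'm) dgmod" and ?f = "\<lambda>_ :: 'm. undefined :: 'm"
  interpret M: dg_module A M by fact
  have sub: "additive_subgroup (gr M i) M" for i using M.gr_grading by (simp add: grading_def)
  have "quasi_iso A M ?Z ?f"
    unfolding quasi_iso_def
  proof (intro conjI allI)
    show "?f \<in> dg_hom A M ?Z" by (auto simp: dg_hom_def zero_dgmod_def)
    fix i
    obtain c where c: "cohomology M i = {c}" using acyclic by blast
    then have "c \<in> cohomology M i" by simp
    then obtain x where x: "x \<in> gr M i" "c = coboundaries M i +>\<^bsub>M\<^esub> x"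
      by (auto simp: cohomology_def cocycles_def)
    \<comment> \<open>The induced map is a union over a coset, so the coset must be shown non-empty
      for the union to be \<open>{undefined}\<close> and not the empty set.\<close>
    have "\<zero>\<^bsub>M\<^esub> \<in> gr M (i - 1)" using sub M.additive_subgroup_iff by blast
    then have "c \<noteq> {}" using x(2) by (auto simp: a_r_coset_def' coboundaries_def)
    then have "cohomology_map ?Z ?f i c = {undefined}"
      by (simp add: cohomology_map_def coboundaries_def zero_dgmod_def a_r_coset_def')
    then show "bij_betw (cohomology_map ?Z ?f i) (cohomology M i) (cohomology ?Z i)"
      by (simp add: c cohomology_zero_dgmod bij_betw_def)
  qed
  then show ?thesis
    unfolding derived_iso_def using M dg_module_zero_dgmod by (intro r_into_equivclp) blast
qed

lemma right_dg_moduleI: "\<lbrakk>dg_algebra k A; dg_module A N\<rbrakk> \<Longrightarrow> right_dg_module k A N"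
  by (simp add: right_dg_module_def dg_algebra_ring)

theorem theorem1p1:
  fixes k :: "'k ring"
    and A :: "('k, 'a) dga"
    and M :: "('a, 'm) dgmod"
    and T :: "('a, ('p \<times> 'a set \<Rightarrow>\<^sub>0 int) set) dgmod"
  assumes "field k"
    and "fd_dg_algebra k A"
    and "separable_algebra k (quotient_algebra A (jacobson_radical A))"
    and "dg_module A M"
    and "derived_tensor A M (quotient_dgbimod A (J_minus A)) T"
    and "derived_iso A T zero_dgmod"
  shows "derived_iso A M zero_dgmod"
proof (rule derived_iso_zeroI)
  show "dg_module A M" by fact
  have dg: "dg_algebra k A" using assms(2) by (simp add: fd_dg_algebra_def)
  have J: "ideal (J_minus A) A" using ideal_J_minus[OF dg] .
  note module = right_dg_moduleI[OF dg]
  obtain P :: "('a, 'p) dgmod" and q where P: "semifree A P" "quasi_iso A P M q"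
    and T: "T = dg_tensor A P (quotient_dgbimod A (J_minus A))"
    using assms(5) unfolding derived_tensor_def by blast
  obtain E and rank :: "'p \<Rightarrow> nat" where "E \<subseteq> (\<Union>i. gr P i)"
    "\<forall>x\<in>carrier P. \<exists>!c. lin_comb A P E c x"
    "\<forall>e\<in>E. \<exists>c. lin_comb A P {e' \<in> E. rank e' < rank e} c (diff P e)"
    using P(1) unfolding semifree_def by blast
  moreover have P': "right_dg_module k A P"
    using P(1) unfolding semifree_def by (intro module) (rule conjunct1)
  ultimately interpret P: semifree_module k A P E rank
    by (simp add: semifree_module_def semifree_module_axioms_def)
  interpret R: dg_module_reduction k A P "J_minus A"
    using P' J J_minus_alg_d[OF dg] by (simp add: dg_module_reduction_def dg_module_reduction_axioms_def)
  have T': "dg_module A T" "\<And>i. \<exists>c. cohomology T i = {c}"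
    using derived_iso_zero_imp[OF assms(6)] by auto
  have "t \<in> diff T ` gr T (n - 1)" if "t \<in> gr T n" "diff T t = \<zero>\<^bsub>T\<^esub>" for n t
    using T'(2)[of n] that unfolding right_dg_module.trivial_cohomology_iff[OF module[OF T'(1)]] by simp
  then have reduction: "\<exists>w\<in>gr P (n - 1). y \<ominus>\<^bsub>P\<^esub> diff P w \<in> P.generated_by (J_minus A)"
    if "y \<in> gr P n" "diff P y \<in> P.generated_by (J_minus A)" for n y
    using R.acyclic_reduction[OF _ _ that] T'(1) unfolding T by simp
  have right: "right_ideal A (J_minus A)"
    using J ideal.I_r_closed[OF J] by (simp add: right_ideal_def ideal_def)
  obtain N where "ideal_products A (J_minus A) N \<subseteq> {\<zero>\<^bsub>A\<^esub>}"
    using J_minus_nilpotent[OF assms(2)] by blast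
  then have "x \<in> diff P ` gr P (i - 1)" if "x \<in> gr P i" "diff P x = \<zero>\<^bsub>P\<^esub>" for x i
    by (rule P.acyclic_lift[OF right _ reduction that])
  then have acyclic: "\<exists>c. cohomology P i = {c}" for i
    unfolding P.trivial_cohomology_iff by blast
  \<comment> \<open>The vanishing just obtained for the resolution \<open>P\<close> is carried over
    to \<open>M\<close> by the bijections on cohomology.\<close>
  have bij: "bij_betw (cohomology_map M q i) (cohomology P i) (cohomology M i)" for i
    using P(2) by (simp add: quasi_iso_def)
  show "\<exists>c. cohomology M i = {c}" for i
    using acyclic unfolding bij_betw_singleton_iff[OF bij] .
qed

end
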